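(* Let $r$ be a constant and let \[ \Big(\{f_{A_1,\dots,A_r}\},\ \{(n_i,k_i,\ell_i)\}_{i\in[r]},\ \{I_y\},\ C,\ \alpha,\ D,\ \{\mathcal G_{A_1,\dots,A_r,\lambda}\}\Big) \] be an admissible configuration of an $r$-level nested Johnson walk for the function $f=\bigvee f_{A_1,\dots,A_r}\colon\{0,1\}^N\to\{0,1\}$. Let $\mathbf S,\mathbf U_1,\dots,\mathbf U_r,\mathbf C>0$ be values such that for every $x\in f^{-1}(0)$ the following hold, where all random choices are uniform and independent, and "$A\sim\binom{[n_i]}{h}$" means that $A$ is a uniformly random element of $\mathcal P([n_i],k_i)$ with $|A|=h$: (1) $\displaystyle \mathop{\mathbb E}_{A'_i\sim\binom{[n_i]}{k_i-\ell_i}\ \forall i\in[r]} |D(A'_1,\dots,A'_r)|^2\le \mathbf S^2$; (2) $\displaystyle \mathop{\mathbb E}_{A_i\sim\binom{[n_i]}{k_i}\ \forall i\in[r]}\Big[C_0\big(\mathcal G_{A_1,\dots,A_r,x_{D(A_1,\dots,A_r)}},x\big)\cdot C_1\big(\mathcal G_{A_1,\dots,A_r,x_{D(A_1,\dots,A_r)}}\big)\Big]\le \mathbf C^2$; (3) for every $i\in[r]$ and every integer $h$ with $k_i-\ell_i\le h<k_i$, \[ \mathop{\mathbb E}\ \big|D(A_1,\dots,A_i\cup\{v\},\dots,A_r)\setminus D(A_1,\dots,A_r)\big|^2\le \mathbf U_i^2, \] where the expectation is over $A_j\sim\binom{[n_j]}{k_j}$ for $j\le i-1$, $A_j\sim\binom{[n_j]}{k_j-\ell_j}$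 for $j\ge i+1$, $A_i\sim\binom{[n_i]}{h}$, and $v$ uniform in $[n_i]\setminus A_i$ (with $A_i\cup\{v\}$ obtained by replacing a uniformly random $\star$ of $A_i$ by $v$). Then there is an adaptive learning graph $\mathcal G$ for $f$ such that for every $x\in f^{-1}(0)$ and $y\in f^{-1}(1)$ we have $C_1(\mathcal G,y)\le 1$ and \[ C_0(\mathcal G,x)=O\!\left(\mathbf S^2+\sum_{i=1}^r\Big(\prod_{j=1}^i\Big(\frac{n_j}{k_j}\Big)^{\ell_j}\Big)k_i\,\mathbf U_i^2+\Big(\prod_{i=1}^r\Big(\frac{n_i}{k_i}\Big)^{\ell_i}\Big)\mathbf C^2\right). \]
   Context: **Adaptive learning graphs.** Let $f$ be a (possibly partial) Boolean function with domain $\mathcal D\subseteq\{0,1\}^N$. A 1-certificate of $y\in f^{-1}(1)$ is a set $S\subseteq[N]$ such that $f(z)=1$ for all $z\in\mathcal D$ with $z_S=y_S$. An adaptive learning graph for $f$ is a directed acyclic graph $\mathcal G=(\mathcal V,\mathcal E)$ such that: every vertex $v$ has a label $s(v)\subseteq[N]$; there is a root vertex with label $\emptyset$; every directed edge $e=\overrightarrow{uv}$ satisfies $s(u)\subseteq s(v)$ and has length $l(e)=|s(v)\setminus s(u)|$; for every $z\in\mathcal D$ and every edge $e=\overrightarrow{uv}$ there is a weight $w_z(e)>0$ depending only on $e$ and on $z_{s(v)}$ (the restriction of $z$ to $s(v)$); every $y\in f^{-1}(1)$ has a flow $p_y$ of value $1$ on $\mathcal G$ whose source is the root and whose sinks are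 vertices $v$ such that $s(v)$ contains a 1-certificate of $y$. Complexities: for $x\in f^{-1}(0)$, $C_0(\mathcal G,x)=\sum_{e\in\mathcal E}l(e)w_x(e)$; for $y\in f^{-1}(1)$, $C_1(\mathcal G,y)=\sum_{e\in\mathcal E}l(e)\,p_y(e)^2/w_y(e)$; $C_1(\mathcal G)=\max_{y\in f^{-1}(1)}C_1(\mathcal G,y)$. **Ordered partial subsets.** For a set $X$ and integer $k$, $\mathcal P(X,k)$ is the set of tuples $(x_1,\dots,x_k)\in(X\cup\{\star\})^k$ such that for $i\ne j$, $x_i=x_j$ implies $x_i=\star$; $\mathcal P(X,=k)$ is the set of tuples in $X^k$ with pairwise distinct entries. An element $A\in\mathcal P(X,k)$ is also treated as the set of its non-$\star$ entries, and $|A|$ is the number of non-$\star$ entries. If $|A|<k$ and $v\in X\setminus A$, $A\cup\{v\}$ denotes the result of replacing a (random) $\star$ of $A$ by $v$; adding a set of elements means adding them one after another. For $A,B\in\mathcal P(X,k)$, $A\subseteq B$ means $A_i=B_i$ whenever $A_i\neq\star$. **Configuration.** All objects below may depend on a growing parameter $n$; asymptotic notation refers to $n\to\infty$. The number of levels $r$ and the integers $\ell_i$ are constants. A configuration consists of: - integers $(n_i,k_i,\ell_i)$, $i\in[r]$, with $0<\ell_i\le k_i=o(n_i)$, and a function $\alpha=\alpha(n)=o(1)$; - Boolean functions $f_{A_1,\dots,A_r}\colon\{0,1\}^N\to\{0,1\}$ for $A_i\in\mathcal P([n_i],=k_i)$, $i\in[r]$; the function to compute is $f=\bigvee_{A_i\in\mathcal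 P([n_i],=k_i),\,i\in[r]}f_{A_1,\dots,A_r}$; - a data structure $D\colon\prod_{i=1}^r\mathcal P([n_i],k_i)\to 2^{[N]}$, monotone under inclusion $\subseteq$ in each coordinate; - for each $y\in f^{-1}(1)$, certificates $I_y=(I_{y,1},\dots,I_{y,r})$ with $I_{y,i}\in\binom{[n_i]}{\ell_i}$ (an $\ell_i$-element subset of $[n_i]$), where $I_{y,i}$ may depend on previously chosen states $A'_1,\dots,A'_{i-1}$; write $\overline{I_{y,i}}=\{A'_i\in\mathcal P([n_i],k_i):|A'_i|=k_i-\ell_i,\ A'_i\cap I_{y,i}=\emptyset\}$; - an availability function $C$ (depending on $y$) assigning to states $A'_1,\dots,A'_{i-1}$ a set $C(A'_1,\dots,A'_{i-1})\subseteq\overline{I_{y,i}}$; it is called an $\alpha$-subset of $\overline{I_{y,i}}$ if a uniformly random $A'_i\in\overline{I_{y,i}}$ lies outside it with probability at most $\alpha$; - for each $(A_1,\dots,A_r)$ with $A_i\in\mathcal P([n_i],=k_i)$ and each assignment $\lambda$ of the bits indexed by $D(A_1,\dots,A_r)$, an adaptive learning graph $\mathcal G_{A_1,\dots,A_r,\lambda}$ for the partial function $f_{A_1,\dots,A_r,\lambda}$, which is $f_{A_1,\dots,A_r}$ restricted to the inputs $z$ with $z_{D(A_1,\dots,A_r)}=\lambda$. **Admissibility.** The configuration is admissible if for every $y\in f^{-1}(1)$: there are $I_{y,1}\in\binom{[n_1]}{\ell_1}$ and an $\alpha$-subset $C()\subseteq\overline{I_{y,1}}$ such that for every $A'_1\in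 C()$ there are $I_{y,2}\in\binom{[n_2]}{\ell_2}$ and an $\alpha$-subset $C(A'_1)\subseteq\overline{I_{y,2}}$ such that for every $A'_2\in C(A'_1)$, $\dots$, there are $I_{y,r}\in\binom{[n_r]}{\ell_r}$ and an $\alpha$-subset $C(A'_1,\dots,A'_{r-1})\subseteq\overline{I_{y,r}}$ such that for every $A'_r\in C(A'_1,\dots,A'_{r-1})$ one has $f_{A'_1\cup I_{y,1},\dots,A'_r\cup I_{y,r}}(y)=1$ (for every way of filling the $\star$ positions of $A'_i$ with the elements of $I_{y,i}$). *)

theory Defs
  imports "HOL-Probability.Probability" "HOL-Library.Landau_Symbols"
begin

section \<open>Adaptive learning graphs\<close>

text \<open>
  Inputs are the functions in \<open>cube N\<close>, coordinates are numbered from \<open>0\<close>, and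
  \<open>restrict z S\<close> is the restriction \<open>z\<^sub>S\<close>. A partial Boolean function is given by its domain \<open>Dm\<close>
  together with a predicate, which is only evaluated on \<open>Dm\<close>.
\<close>

type_synonym input = "nat \<Rightarrow> bool"

definition cube :: "nat \<Rightarrow> input set" where
  "cube N = {..<N} \<rightarrow>\<^sub>E UNIV"

definition one_certificate :: "nat \<Rightarrow> input set \<Rightarrow> (input \<Rightarrow> bool) \<Rightarrow> input \<Rightarrow> nat set \<Rightarrow> bool" where
  "one_certificate N Dm f y S \<longleftrightarrow>
     S \<subseteq> {..<N} \<and> (\<forall>z\<in>Dm. restrict z S = restrict y S \<longrightarrow> f z)"

record 'v learning_graph =
  lg_verts :: "'v set"
  lg_edges :: "('v \<times> 'v) set"
  lg_root :: 'v
  lg_label :: "'v \<Rightarrow> nat set"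
  lg_weight :: "input \<Rightarrow> 'v \<times> 'v \<Rightarrow> real"
  lg_flow :: "input \<Rightarrow> 'v \<times> 'v \<Rightarrow> real"

definition edge_length :: "'v learning_graph \<Rightarrow> 'v \<times> 'v \<Rightarrow> nat" where
  "edge_length G e = card (lg_label G (snd e) - lg_label G (fst e))"

definition outflow :: "('v \<times> 'v) set \<Rightarrow> ('v \<times> 'v \<Rightarrow> real) \<Rightarrow> 'v \<Rightarrow> real" where
  "outflow E p v = (\<Sum>e | e \<in> E \<and> fst e = v. p e)"

definition inflow :: "('v \<times> 'v) set \<Rightarrow> ('v \<times> 'v \<Rightarrow> real) \<Rightarrow> 'v \<Rightarrow> real" where
  "inflow E p v = (\<Sum>e | e \<in> E \<and> snd e = v. p e)"

definition unit_flow ::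
  "'v set \<Rightarrow> ('v \<times> 'v) set \<Rightarrow> 'v \<Rightarrow> 'v set \<Rightarrow> ('v \<times> 'v \<Rightarrow> real) \<Rightarrow> bool" where
  "unit_flow V E s T p \<longleftrightarrow>
     (\<forall>e\<in>E. 0 \<le> p e) \<and>
     outflow E p s - inflow E p s = 1 \<and>
     (\<forall>v\<in>V - {s}. if v \<in> T then outflow E p v \<le> inflow E p v
                   else outflow E p v = inflow E p v)"

definition adaptive_learning_graph ::
  "nat \<Rightarrow> input set \<Rightarrow> (input \<Rightarrow> bool) \<Rightarrow> 'v learning_graph \<Rightarrow> bool" where
  "adaptive_learning_graph N Dm f G \<longleftrightarrow>
     finite (lg_verts G) \<and>
     lg_edges G \<subseteq> lg_verts G \<times> lg_verts G \<and>
     acyclic (lg_edges G) \<and>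
     (\<forall>v\<in>lg_verts G. lg_label G v \<subseteq> {..<N}) \<and>
     lg_root G \<in> lg_verts G \<and> lg_label G (lg_root G) = {} \<and>
     (\<forall>(u, v)\<in>lg_edges G. lg_label G u \<subseteq> lg_label G v) \<and>
     (\<forall>z\<in>Dm. \<forall>e\<in>lg_edges G. 0 < lg_weight G z e) \<and>
     (\<forall>(u, v)\<in>lg_edges G. \<forall>z\<in>Dm. \<forall>z'\<in>Dm.
        restrict z (lg_label G v) = restrict z' (lg_label G v) \<longrightarrow>
        lg_weight G z (u, v) = lg_weight G z' (u, v)) \<and>
     (\<forall>y\<in>Dm. f y \<longrightarrow>
        unit_flow (lg_verts G) (lg_edges G) (lg_root G)
          {v \<in> lg_verts G. \<exists>S\<subseteq>lg_label G v. one_certificate N Dm f y S}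
          (lg_flow G y))"

definition C0 :: "'v learning_graph \<Rightarrow> input \<Rightarrow> real" where
  "C0 G x = (\<Sum>e\<in>lg_edges G. real (edge_length G e) * lg_weight G x e)"

definition C1 :: "'v learning_graph \<Rightarrow> input \<Rightarrow> real" where
  "C1 G y = (\<Sum>e\<in>lg_edges G. real (edge_length G e) * (lg_flow G y e)\<^sup>2 / lg_weight G y e)"

text \<open>
  As \<open>C1 G y \<ge> 0\<close>, the inserted \<open>0\<close> matters only for a function without positive inputs, for which
  the maximum over the empty set is read as \<open>0\<close>.
\<close>

definition C1_max :: "input set \<Rightarrow> (input \<Rightarrow> bool) \<Rightarrow> 'v learning_graph \<Rightarrow> real" where
  "C1_max Dm f G = Max (insert 0 (C1 G ` {y \<in> Dm. f y}))"


section \<open>Ordered partial subsets\<close>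

text \<open>The entry \<open>None\<close> plays the role of the star.\<close>

type_synonym state = "nat option list"

definition partial_subsets :: "nat set \<Rightarrow> nat \<Rightarrow> state set" where
  "partial_subsets X k = {A. length A = k \<and> set A \<subseteq> insert None (Some ` X) \<and>
     (\<forall>i<k. \<forall>j<k. i \<noteq> j \<and> A ! i = A ! j \<longrightarrow> A ! i = None)}"

definition full_subsets :: "nat set \<Rightarrow> nat \<Rightarrow> state set" where
  "full_subsets X k = {A. length A = k \<and> set A \<subseteq> Some ` X \<and> distinct A}"

definition elems :: "state \<Rightarrow> nat set" where
  "elems A = {x. Some x \<in> set A}"

definition filled :: "state \<Rightarrow> nat" where
  "filled A = card {i. i < length A \<and> A ! i \<noteq> None}"

definition stars :: "state \<Rightarrow> nat set" where
  "stars A = {i. i < length A \<and> A ! i = None}"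

definition state_le :: "state \<Rightarrow> state \<Rightarrow> bool" where
  "state_le A B \<longleftrightarrow> length A = length B \<and> (\<forall>i<length A. A ! i \<noteq> None \<longrightarrow> A ! i = B ! i)"

definition layer :: "nat \<Rightarrow> nat \<Rightarrow> nat \<Rightarrow> state set" where
  "layer n k h = {A \<in> partial_subsets {..<n} k. filled A = h}"

definition fillings :: "nat \<Rightarrow> nat \<Rightarrow> state \<Rightarrow> nat set \<Rightarrow> state set" where
  "fillings n k A J = {B \<in> full_subsets {..<n} k. state_le A B \<and> elems B = elems A \<union> J}"

definition tuples :: "nat \<Rightarrow> (nat \<Rightarrow> state set) \<Rightarrow> state list set" where
  "tuples r X = {As. length As = r \<and> (\<forall>i<r. As ! i \<in> X i)}"

definition uniform_expectation :: "'a set \<Rightarrow> ('a \<Rightarrow> real) \<Rightarrow> real" where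
  "uniform_expectation X g = measure_pmf.expectation (pmf_of_set X) g"


section \<open>Configurations of a nested Johnson walk\<close>

text \<open>
  Levels are numbered from \<open>0\<close>. The certificate \<open>cf_cert c y [A'\<^sub>0, \<dots>, A'\<^sub>i\<^sub>-\<^sub>1]\<close> and the set
  \<open>cf_avail c y [A'\<^sub>0, \<dots>, A'\<^sub>i\<^sub>-\<^sub>1]\<close> of available states belong to level \<open>i\<close>, the length of the list of
  previously chosen states. The constants \<open>r\<close> and \<open>l\<close> are kept outside the record because they do
  not vary with the growing parameter.
\<close>

record 'v configuration =
  cf_N :: nat
  cf_n :: "nat \<Rightarrow> nat"
  cf_k :: "nat \<Rightarrow> nat"
  cf_alpha :: real
  cf_fun :: "state list \<Rightarrow> input \<Rightarrow> bool"
  cf_data :: "state list \<Rightarrow> nat set"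
  cf_cert :: "input \<Rightarrow> state list \<Rightarrow> nat set"
  cf_avail :: "input \<Rightarrow> state list \<Rightarrow> state set"
  cf_graph :: "state list \<Rightarrow> input \<Rightarrow> 'v learning_graph"

definition full_tuples :: "nat \<Rightarrow> 'v configuration \<Rightarrow> state list set" where
  "full_tuples r c = tuples r (\<lambda>i. full_subsets {..<cf_n c i} (cf_k c i))"

definition partial_tuples :: "nat \<Rightarrow> 'v configuration \<Rightarrow> state list set" where
  "partial_tuples r c = tuples r (\<lambda>i. partial_subsets {..<cf_n c i} (cf_k c i))"

definition target :: "nat \<Rightarrow> 'v configuration \<Rightarrow> input \<Rightarrow> bool" where
  "target r c z \<longleftrightarrow> (\<exists>As\<in>full_tuples r c. cf_fun c As z)"

definition zeros :: "nat \<Rightarrow> 'v configuration \<Rightarrow> input set" where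
  "zeros r c = {x \<in> cube (cf_N c). \<not> target r c x}"

definition ones :: "nat \<Rightarrow> 'v configuration \<Rightarrow> input set" where
  "ones r c = {y \<in> cube (cf_N c). target r c y}"

definition subdomain :: "'v configuration \<Rightarrow> state list \<Rightarrow> input \<Rightarrow> input set" where
  "subdomain c As lam = {z \<in> cube (cf_N c). restrict z (cf_data c As) = lam}"

definition valid_configuration :: "nat \<Rightarrow> (nat \<Rightarrow> nat) \<Rightarrow> 'v configuration \<Rightarrow> bool" where
  "valid_configuration r l c \<longleftrightarrow>
     (\<forall>i<r. 0 < l i \<and> l i \<le> cf_k c i) \<and>
     (\<forall>As\<in>partial_tuples r c. cf_data c As \<subseteq> {..<cf_N c}) \<and>
     (\<forall>As\<in>partial_tuples r c. \<forall>i<r. \<forall>B\<in>partial_subsets {..<cf_n c i} (cf_k c i).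
        state_le (As ! i) B \<longrightarrow> cf_data c As \<subseteq> cf_data c (As[i := B])) \<and>
     (\<forall>As\<in>full_tuples r c. \<forall>lam \<in> cf_data c As \<rightarrow>\<^sub>E UNIV.
        adaptive_learning_graph (cf_N c) (subdomain c As lam) (cf_fun c As) (cf_graph c As lam))"

definition avoiding :: "nat \<Rightarrow> nat \<Rightarrow> nat \<Rightarrow> nat set \<Rightarrow> state set" where
  "avoiding n k l J = {A \<in> layer n k (k - l). elems A \<inter> J = {}}"

definition alpha_subset :: "real \<Rightarrow> state set \<Rightarrow> state set \<Rightarrow> bool" where
  "alpha_subset a X Y \<longleftrightarrow> X \<subseteq> Y \<and> measure_pmf.prob (pmf_of_set Y) (- X) \<le> a"

definition reachable :: "'v configuration \<Rightarrow> input \<Rightarrow> state list \<Rightarrow> bool" where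
  "reachable c y As \<longleftrightarrow> (\<forall>j<length As. As ! j \<in> cf_avail c y (take j As))"

definition admissible :: "nat \<Rightarrow> (nat \<Rightarrow> nat) \<Rightarrow> 'v configuration \<Rightarrow> bool" where
  "admissible r l c \<longleftrightarrow>
     valid_configuration r l c \<and>
     (\<forall>y\<in>ones r c.
        (\<forall>i<r. \<forall>As. length As = i \<and> reachable c y As \<longrightarrow>
           cf_cert c y As \<subseteq> {..<cf_n c i} \<and> card (cf_cert c y As) = l i \<and>
           alpha_subset (cf_alpha c) (cf_avail c y As)
             (avoiding (cf_n c i) (cf_k c i) (l i) (cf_cert c y As))) \<and>
        (\<forall>As. length As = r \<and> reachable c y As \<longrightarrow>
           (\<forall>Bs \<in> tuples r (\<lambda>i. fillings (cf_n c i) (cf_k c i) (As ! i) (cf_cert c y (take i As))).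
              cf_fun c Bs y)))"

definition setup_cost :: "nat \<Rightarrow> (nat \<Rightarrow> nat) \<Rightarrow> 'v configuration \<Rightarrow> real" where
  "setup_cost r l c =
     uniform_expectation (tuples r (\<lambda>i. layer (cf_n c i) (cf_k c i) (cf_k c i - l i)))
       (\<lambda>As. (real (card (cf_data c As)))\<^sup>2)"

definition checking_cost :: "nat \<Rightarrow> 'v configuration \<Rightarrow> input \<Rightarrow> real" where
  "checking_cost r c x =
     uniform_expectation (tuples r (\<lambda>i. layer (cf_n c i) (cf_k c i) (cf_k c i)))
       (\<lambda>As. let lam = restrict x (cf_data c As); G = cf_graph c As lam
             in C0 G x * C1_max (subdomain c As lam) (cf_fun c As) G)"

definition update_cost :: "nat \<Rightarrow> (nat \<Rightarrow> nat) \<Rightarrow> 'v configuration \<Rightarrow> nat \<Rightarrow> nat \<Rightarrow> real" where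
  "update_cost r l c i h =
     uniform_expectation
       (tuples r (\<lambda>j. layer (cf_n c j) (cf_k c j)
          (if j < i then cf_k c j else if j = i then h else cf_k c j - l j)))
       (\<lambda>As. uniform_expectation ({..<cf_n c i} - elems (As ! i))
         (\<lambda>v. uniform_expectation (stars (As ! i))
           (\<lambda>p. (real (card (cf_data c (As[i := (As ! i)[p := Some v]]) - cf_data c As)))\<^sup>2)))"

end

theory Submission imports Defs begin

text \<open>
  The learning graph loads \<open>D(A')\<close> for tuples of states \<open>A'\<close> of size \<open>k\<^sub>i - l\<^sub>i\<close>, then adds \<open>l\<^sub>i\<close> elements
  to the states level by level, and finally runs the inner learning graphs. For a positive input the
  flow follows a random walk: \<open>A'\<close> is chosen uniformly among the available states, one level after
  another, and the certificate elements are then added in a fixed order. Certificates depend only on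
  earlier levels, so \<open>A'\<close> can be recovered from every later state; the flow through an edge is
  therefore at most \<open>M\<close>, the largest probability of a single \<open>A'\<close>, and the sum of the squared flows
  of a layer is at most \<open>M\<close>. Weights equal to \<open>M\<close> times the length of the edge, up to a constant,
  then give \<open>C1 \<le> 1\<close>, and \<open>C0\<close> becomes \<open>M\<close> times a sum of squared lengths over all edges, that is, the
  expected squared length times \<open>M\<close> times the number of edges. This last product is of the order
  of the products of the ratios \<open>n\<^sub>j / k\<^sub>j\<close>, since \<open>M\<close> is within a constant factor of the inverse of the
  number of starting tuples.
\<close>

section \<open>Transport and normalisation of learning graphs\<close>

text \<open>The obstacle is that the flow is far from uniform: certificates and available states
  depend on the input and on earlier choices, so the flow through a single edge cannot be computed.
  Only the upper bound \<open>M\<close> is used, and the weights of the walk edges do not depend on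
  the input at all. The inner graphs are rescaled beforehand to have \<open>C1\<close> at most 1;
  the product of their two complexities then becomes their \<open>C0\<close>, and together they
  behave like one more layer. An inner graph depends on the bits already read, so one copy is
  attached for every assignment; the copies that do not match the input carry no flow, but still
  need positive weights, which are made negligible. The slack from these weights and from the
  rescaling is chosen as \<open>S\<^sup>2\<close> and \<open>C\<^sup>2\<close>, so that the final
  bound absorbs it.\<close>

lemma C0_nonneg:
  assumes "adaptive_learning_graph N Dm f G" "x \<in> Dm"
  shows "0 \<le> C0 G x"
  using assms unfolding C0_def adaptive_learning_graph_def
  by (intro sum_nonneg mult_nonneg_nonneg) (auto simp: less_imp_le)

lemma learning_graph_weight_local:
  assumes "adaptive_learning_graph N Dm f G" "(u, v) \<in> lg_edges G" "z \<in> Dm" "z' \<in> Dm"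
    "restrict z (lg_label G v) = restrict z' (lg_label G v)"
  shows "lg_weight G z (u, v) = lg_weight G z' (u, v)"
proof -
  have "\<forall>(u, v)\<in>lg_edges G. \<forall>z\<in>Dm. \<forall>z'\<in>Dm.
      restrict z (lg_label G v) = restrict z' (lg_label G v) \<longrightarrow>
      lg_weight G z (u, v) = lg_weight G z' (u, v)"
    using assms(1) unfolding adaptive_learning_graph_def by (elim conjE) assumption
  from bspec[OF this assms(2), unfolded prod.case] show ?thesis
    using assms(3-) by blast
qed

lemma finite_lg_edges:
  assumes "adaptive_learning_graph N Dm f G"
  shows "finite (lg_edges G)"
  using assms unfolding adaptive_learning_graph_def by (meson finite_SigmaI finite_subset)

text \<open>The combined graph has vertices built from states, assignments and inner vertices.
  Transport along an injection into the naturals gives the single vertex type of the final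
  statement.\<close>

lemma learning_graph_on_nat:
  fixes G :: "'v learning_graph"
  assumes alg: "adaptive_learning_graph N Dm f G"
  shows "\<exists>H :: nat learning_graph. adaptive_learning_graph N Dm f H \<and>
           (\<forall>x. C0 H x = C0 G x) \<and> (\<forall>y. C1 H y = C1 G y)"
proof -
  let ?V = "lg_verts G" and ?E = "lg_edges G"
  note G = alg[unfolded adaptive_learning_graph_def]
  obtain h :: "'v \<Rightarrow> nat" where h: "inj_on h ?V"
    using finite_imp_inj_to_nat_seg[of ?V] G by metis
  \<comment> \<open>\<open>g\<close> inverts \<open>h\<close> on vertices only. Labels, weights and
    flows are pulled back along it, so every use needs membership in \<open>?V\<close>.\<close>
  define g where "g = inv_into ?V h"
  have gh [simp]: "g (h v) = v" if "v \<in> ?V" for v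
    using that h by (simp add: g_def)
  have EV: "u \<in> ?V" "v \<in> ?V" if "(u, v) \<in> ?E" for u v
    using G that by auto
  have inj: "inj_on (map_prod h h) ?E"
    using h EV by (auto simp: inj_on_def)
  define H where "H = \<lparr>lg_verts = h ` ?V, lg_edges = map_prod h h ` ?E, lg_root = h (lg_root G),
     lg_label = lg_label G \<circ> g, lg_weight = \<lambda>z e. lg_weight G z (map_prod g g e),
     lg_flow = \<lambda>z e. lg_flow G z (map_prod g g e)\<rparr>"
  have Hs: "lg_verts H = h ` ?V" "lg_edges H = map_prod h h ` ?E" "lg_root H = h (lg_root G)"
     "lg_label H = lg_label G \<circ> g" "lg_weight H = (\<lambda>z e. lg_weight G z (map_prod g g e))"
     "lg_flow H = (\<lambda>z e. lg_flow G z (map_prod g g e))"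
    by (simp_all add: H_def)
  have gE: "map_prod g g (map_prod h h e) = e" if "e \<in> ?E" for e
    using that EV by (cases e) auto
  have C0: "C0 H x = C0 G x" for x
    unfolding C0_def Hs sum.reindex[OF inj] o_def
    by (rule sum.cong) (auto simp: gE edge_length_def Hs EV)
  have C1: "C1 H y = C1 G y" for y
    unfolding C1_def Hs sum.reindex[OF inj] o_def
    by (rule sum.cong) (auto simp: gE edge_length_def Hs EV)
  \<comment> \<open>A cycle of the image would be carried back by \<open>g\<close> to a cycle of
    \<open>G\<close>.\<close>
  have tr: "(g a, g b) \<in> ?E\<^sup>+" if "(a, b) \<in> (map_prod h h ` ?E)\<^sup>+" for a b
    using that
  proof (induction rule: trancl_induct)
    case (base y)
    then show ?case using EV by auto
  next
    case (step y z)
    then have "(g y, g z) \<in> ?E" using EV by auto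
    with step.IH show ?case by (rule trancl_into_trancl)
  qed
  have acyc: "acyclic (lg_edges H)"
    unfolding Hs acyclic_def
  proof clarify
    fix a assume "(a, a) \<in> (map_prod h h ` ?E)\<^sup>+"
    from tr[OF this] show False using G by (auto simp: acyclic_def)
  qed
  have hEV: "h (fst e) = h v \<longleftrightarrow> fst e = v" "h (snd e) = h v \<longleftrightarrow> snd e = v"
    if "e \<in> ?E" "v \<in> ?V" for e v
    using that EV inj_on_eq_iff[OF h] by (cases e; simp)+
  have out: "outflow (map_prod h h ` ?E) (\<lambda>e. p (map_prod g g e)) (h v) = outflow ?E p v"
    if "v \<in> ?V" for p v
  proof -
    have "{e \<in> map_prod h h ` ?E. fst e = h v} = map_prod h h ` {e \<in> ?E. h (fst e) = h v}"
      by (auto simp: fst_map_prod)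
    also have "{e \<in> ?E. h (fst e) = h v} = {e \<in> ?E. fst e = v}"
      using hEV that by blast
    finally have "{e \<in> map_prod h h ` ?E. fst e = h v} = map_prod h h ` {e \<in> ?E. fst e = v}" .
    moreover have "inj_on (map_prod h h) {e \<in> ?E. fst e = v}"
      using inj by (rule inj_on_subset) blast
    ultimately show ?thesis
      unfolding outflow_def by (auto simp: sum.reindex gE intro!: sum.cong simp del: map_prod_simp)
  qed
  have inn: "inflow (map_prod h h ` ?E) (\<lambda>e. p (map_prod g g e)) (h v) = inflow ?E p v"
    if "v \<in> ?V" for p v
  proof -
    have "{e \<in> map_prod h h ` ?E. snd e = h v} = map_prod h h ` {e \<in> ?E. h (snd e) = h v}"
      by (auto simp: snd_map_prod)
    also have "{e \<in> ?E. h (snd e) = h v} = {e \<in> ?E. snd e = v}"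
      using hEV that by blast
    finally have "{e \<in> map_prod h h ` ?E. snd e = h v} = map_prod h h ` {e \<in> ?E. snd e = v}" .
    moreover have "inj_on (map_prod h h) {e \<in> ?E. snd e = v}"
      using inj by (rule inj_on_subset) blast
    ultimately show ?thesis
      unfolding inflow_def by (auto simp: sum.reindex gE intro!: sum.cong simp del: map_prod_simp)
  qed
  have flow: "unit_flow (lg_verts H) (lg_edges H) (lg_root H)
          {v \<in> lg_verts H. \<exists>S\<subseteq>lg_label H v. one_certificate N Dm f y S} (lg_flow H y)"
    if y: "y \<in> Dm" "f y" for y
  proof -
    let ?T = "{v \<in> ?V. \<exists>S\<subseteq>lg_label G v. one_certificate N Dm f y S}"
    have u: "unit_flow ?V ?E (lg_root G) ?T (lg_flow G y)" and r: "lg_root G \<in> ?V"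
      using G y by auto
    show ?thesis
      unfolding unit_flow_def
    proof (intro conjI ballI)
      fix e assume "e \<in> lg_edges H"
      then show "0 \<le> lg_flow H y e"
        using u gE unfolding Hs unit_flow_def by auto
    next
      show "outflow (lg_edges H) (lg_flow H y) (lg_root H)
          - inflow (lg_edges H) (lg_flow H y) (lg_root H) = 1"
        using u r unfolding Hs unit_flow_def by (simp add: out inn)
    next
      fix w assume w: "w \<in> lg_verts H - {lg_root H}"
      then obtain v where v: "v \<in> ?V" "w = h v" "v \<noteq> lg_root G"
        unfolding Hs by auto
      then have "w \<in> {v \<in> lg_verts H. \<exists>S\<subseteq>lg_label H v. one_certificate N Dm f y S} \<longleftrightarrow> v \<in> ?T"
        unfolding Hs by auto
      then show "if w \<in> {v \<in> lg_verts H. \<exists>S\<subseteq>lg_label H v. one_certificate N Dm f y S}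
         then outflow (lg_edges H) (lg_flow H y) w \<le> inflow (lg_edges H) (lg_flow H y) w
         else outflow (lg_edges H) (lg_flow H y) w = inflow (lg_edges H) (lg_flow H y) w"
        using u v unfolding Hs unit_flow_def by (simp add: out inn)
    qed
  qed
  have "adaptive_learning_graph N Dm f H"
    unfolding adaptive_learning_graph_def
  proof (intro conjI)
    show "\<forall>y\<in>Dm. f y \<longrightarrow> unit_flow (lg_verts H) (lg_edges H) (lg_root H)
          {v \<in> lg_verts H. \<exists>S\<subseteq>lg_label H v. one_certificate N Dm f y S} (lg_flow H y)"
      using flow by blast
    show "acyclic (lg_edges H)" by (rule acyc)
    show "\<forall>(u, v)\<in>lg_edges H. \<forall>z\<in>Dm. \<forall>z'\<in>Dm.
        restrict z (lg_label H v) = restrict z' (lg_label H v) \<longrightarrow>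
        lg_weight H z (u, v) = lg_weight H z' (u, v)"
    proof clarsimp
      fix a b z z' assume *: "(a, b) \<in> lg_edges H" "z \<in> Dm" "z' \<in> Dm"
        "restrict z (lg_label H b) = restrict z' (lg_label H b)"
      then obtain u v where uv: "(u, v) \<in> ?E" "a = h u" "b = h v" unfolding Hs by auto
      with * EV have "restrict z (lg_label G v) = restrict z' (lg_label G v)" by (simp add: Hs)
      then have "lg_weight G z (u, v) = lg_weight G z' (u, v)"
        using G uv * by fast
      then show "lg_weight H z (a, b) = lg_weight H z' (a, b)"
        using uv EV by (simp add: Hs)
    qed
    show "finite (lg_verts H)" using G by (simp add: Hs)
    show "lg_edges H \<subseteq> lg_verts H \<times> lg_verts H" using EV by (auto simp: Hs)
    show "\<forall>v\<in>lg_verts H. lg_label H v \<subseteq> {..<N}" using G by (simp add: Hs)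
    show "lg_root H \<in> lg_verts H" "lg_label H (lg_root H) = {}" using G by (simp_all add: Hs)
    show "\<forall>(u, v)\<in>lg_edges H. lg_label H u \<subseteq> lg_label H v"
    proof clarify
      fix a b i assume *: "(a, b) \<in> lg_edges H" "i \<in> lg_label H a"
      then obtain u v where uv: "(u, v) \<in> ?E" "a = h u" "b = h v" unfolding Hs by auto
      then have "lg_label G u \<subseteq> lg_label G v" using G by blast
      then show "i \<in> lg_label H b" using uv * EV by (auto simp: Hs)
    qed
    show "\<forall>z\<in>Dm. \<forall>e\<in>lg_edges H. 0 < lg_weight H z e"
      using G gE by (simp add: Hs)
  qed
  with C0 C1 show ?thesis by blast
qed

text \<open>
  The additive \<open>\<delta>\<close> is there because weights have to stay positive even if \<open>C1_max\<close> vanishes.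
\<close>

lemma normalised_learning_graph:
  fixes G :: "'v learning_graph"
  assumes alg: "adaptive_learning_graph N Dm f G" and fin: "finite Dm" and "0 < \<delta>"
  shows "\<exists>H :: 'v learning_graph. adaptive_learning_graph N Dm f H \<and> (\<forall>y\<in>Dm. f y \<longrightarrow> C1 H y \<le> 1) \<and>
           (\<forall>x\<in>Dm. C0 H x \<le> C0 G x * C1_max Dm f G + \<delta>)"
proof -
  define B where "B = (\<Sum>x\<in>Dm. C0 G x)"
  \<comment> \<open>Chosen so that \<open>C0 G x * \<epsilon> \<le> \<delta>\<close> for all inputs
    of the finite domain at once; the summand 1 covers \<open>B = 0\<close>.\<close>
  define \<epsilon> where "\<epsilon> = \<delta> / (1 + B)"
  define s where "s = C1_max Dm f G + \<epsilon>"
  have le_B: "C0 G x \<le> B" if "x \<in> Dm" for x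
    unfolding B_def using that fin by (intro member_le_sum C0_nonneg[OF alg]) auto
  have B: "0 \<le> B" unfolding B_def by (intro sum_nonneg C0_nonneg[OF alg])
  have \<epsilon>: "0 < \<epsilon>" and \<epsilon>B: "B * \<epsilon> \<le> \<delta>"
    using B \<open>0 < \<delta>\<close> by (auto simp: \<epsilon>_def field_simps)
  have mx: "C1 G y \<le> C1_max Dm f G" if "y \<in> Dm" "f y" for y
    unfolding C1_max_def using fin that by (intro Max_ge) auto
  have "0 \<le> C1_max Dm f G"
    unfolding C1_max_def using fin by (intro Max_ge) auto
  with \<epsilon> have s: "0 < s" by (simp add: s_def)
  \<comment> \<open>Scaling all weights by \<open>s\<close> divides \<open>C1\<close> by
    \<open>s\<close> and multiplies \<open>C0\<close> by \<open>s\<close>.\<close>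
  define H where "H = G\<lparr>lg_weight := \<lambda>z e. s * lg_weight G z e\<rparr>"
  have Hs [simp]: "lg_verts H = lg_verts G" "lg_edges H = lg_edges G" "lg_root H = lg_root G"
     "lg_label H = lg_label G" "lg_weight H = (\<lambda>z e. s * lg_weight G z e)" "lg_flow H = lg_flow G"
    by (simp_all add: H_def)
  have "adaptive_learning_graph N Dm f H"
    unfolding adaptive_learning_graph_def
  proof (intro conjI)
    show "\<forall>(u, v)\<in>lg_edges H. \<forall>z\<in>Dm. \<forall>z'\<in>Dm.
        restrict z (lg_label H v) = restrict z' (lg_label H v) \<longrightarrow>
        lg_weight H z (u, v) = lg_weight H z' (u, v)"
      using alg s unfolding adaptive_learning_graph_def by fastforce
  qed (use alg s in \<open>simp_all add: adaptive_learning_graph_def\<close>)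
  moreover have "C1 H y \<le> 1" if "y \<in> Dm" "f y" for y
  proof -
    have "C1 H y = C1 G y / s"
      unfolding C1_def sum_divide_distrib by (intro sum.cong) (auto simp: edge_length_def field_simps)
    also have "\<dots> \<le> 1" using mx[OF that] \<epsilon> s by (simp add: s_def field_simps)
    finally show ?thesis .
  qed
  moreover have "C0 H x \<le> C0 G x * C1_max Dm f G + \<delta>" if "x \<in> Dm" for x
  proof -
    have "C0 H x = C0 G x * s"
      unfolding C0_def sum_distrib_right by (intro sum.cong) (auto simp: edge_length_def)
    also have "\<dots> = C0 G x * C1_max Dm f G + C0 G x * \<epsilon>" by (simp add: s_def algebra_simps)
    also have "C0 G x * \<epsilon> \<le> B * \<epsilon>" using le_B[OF that] \<epsilon> by simp
    finally show ?thesis using \<epsilon>B by linarith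
  qed
  ultimately show ?thesis by blast
qed

lemma restrict_eq_subset:
  assumes "restrict z B = restrict z' B" "A \<subseteq> B"
  shows "restrict z A = restrict z' A"
  using assms by (metis inf.absorb_iff2 restrict_restrict)

lemma finite_cube: "finite (cube N)"
  unfolding cube_def by (intro finite_PiE) auto

section \<open>A layered walk followed by inner learning graphs\<close>

text \<open>The time is part of a walk vertex because labels depend on it and because it makes the
  walk acyclic by construction. An inner vertex carries its state and assignment, so that the copies
  of the inner graphs are disjoint.\<close>

datatype ('a, 'v) nested_vertex = Walk nat 'a | Inner 'a input 'v

text \<open>An abstract form of the construction: the sample space \<open>Om y\<close> with weights
  \<open>P y\<close> describes the random walk of a positive input, and \<open>path\<close> its
  trajectory. The inner graphs are taken as already rescaled. Injectivity of trajectories is asked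
  for from time 1 on only, since all of them share the root.\<close>

locale nested_walk =
  fixes N :: nat and f :: "input \<Rightarrow> bool" and T :: nat
    and V :: "nat \<Rightarrow> 'a set" and E :: "nat \<Rightarrow> ('a \<times> 'a) set" and rt :: 'a
    and lab :: "nat \<Rightarrow> 'a \<Rightarrow> nat set" and g :: "'a \<Rightarrow> input \<Rightarrow> bool"
    and G :: "'a \<Rightarrow> input \<Rightarrow> 'v learning_graph"
    and Om :: "input \<Rightarrow> 'w set" and P :: "input \<Rightarrow> 'w \<Rightarrow> real" and path :: "input \<Rightarrow> 'w \<Rightarrow> nat \<Rightarrow> 'a"
    and M :: real
  assumes T_pos: "0 < T" and M_pos: "0 < M"
    and finite_V: "t \<le> T \<Longrightarrow> finite (V t)"
    and E_sub: "t < T \<Longrightarrow> E t \<subseteq> V t \<times> V (Suc t)"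
    and V_0: "V 0 = {rt}" and lab_0: "lab 0 rt = {}"
    and lab_sub: "t \<le> T \<Longrightarrow> a \<in> V t \<Longrightarrow> lab t a \<subseteq> {..<N}"
    and lab_mono: "t < T \<Longrightarrow> (a, b) \<in> E t \<Longrightarrow> lab t a \<subseteq> lab (Suc t) b"
    and inner_graph: "a \<in> V T \<Longrightarrow> lam \<in> lab T a \<rightarrow>\<^sub>E UNIV \<Longrightarrow>
      adaptive_learning_graph N {z \<in> cube N. restrict z (lab T a) = lam} (g a) (G a lam)"
    and inner_C1: "a \<in> V T \<Longrightarrow> y \<in> cube N \<Longrightarrow> g a y \<Longrightarrow> C1 (G a (restrict y (lab T a))) y \<le> 1"
    and g_imp_f: "a \<in> V T \<Longrightarrow> z \<in> cube N \<Longrightarrow> g a z \<Longrightarrow> f z"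
    and finite_Om: "y \<in> cube N \<Longrightarrow> f y \<Longrightarrow> finite (Om y)"
    and P_nonneg: "y \<in> cube N \<Longrightarrow> f y \<Longrightarrow> w \<in> Om y \<Longrightarrow> 0 \<le> P y w"
    and P_le: "y \<in> cube N \<Longrightarrow> f y \<Longrightarrow> w \<in> Om y \<Longrightarrow> P y w \<le> M"
    and P_sum: "y \<in> cube N \<Longrightarrow> f y \<Longrightarrow> (\<Sum>w\<in>Om y. P y w) = 1"
    and path_0: "y \<in> cube N \<Longrightarrow> f y \<Longrightarrow> w \<in> Om y \<Longrightarrow> path y w 0 = rt"
    and path_step: "y \<in> cube N \<Longrightarrow> f y \<Longrightarrow> w \<in> Om y \<Longrightarrow> t < T \<Longrightarrow>
      (path y w t, path y w (Suc t)) \<in> E t"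
    and path_inj: "y \<in> cube N \<Longrightarrow> f y \<Longrightarrow> 0 < t \<Longrightarrow> t \<le> T \<Longrightarrow> inj_on (\<lambda>w. path y w t) (Om y)"
    and path_end: "y \<in> cube N \<Longrightarrow> f y \<Longrightarrow> w \<in> Om y \<Longrightarrow> g (path y w T) y"
begin

section \<open>The combined graph\<close>

definition asg :: "'a \<Rightarrow> input set" where
  "asg a = lab T a \<rightarrow>\<^sub>E UNIV"

definition mass :: "input \<Rightarrow> nat \<Rightarrow> 'a \<Rightarrow> real" where
  "mass y t a = (\<Sum>w | w \<in> Om y \<and> path y w t = a. P y w)"

definition step :: "input \<Rightarrow> nat \<Rightarrow> 'a \<Rightarrow> 'a \<Rightarrow> real" where
  "step y t a b = (\<Sum>w | w \<in> Om y \<and> path y w t = a \<and> path y w (Suc t) = b. P y w)"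

text \<open>The \<open>T\<close> walk layers and the inner stage each contribute at most
  \<open>M / kappa\<close> to \<open>C1\<close>, hence the factor \<open>T + 1\<close>.\<close>

definition kappa :: real where
  "kappa = real (T + 1) * M"

definition gain :: "nat \<Rightarrow> 'a \<Rightarrow> 'a \<Rightarrow> nat" where
  "gain t a b = card (lab (Suc t) b - lab t a)"

definition walk_edges :: "(('a, 'v) nested_vertex \<times> ('a, 'v) nested_vertex) set" where
  "walk_edges = (\<lambda>(t, a, b). (Walk t a, Walk (Suc t) b)) ` (SIGMA t:{..<T}. E t)"

text \<open>Inner roots have empty labels, so these edges have length zero and cost nothing,
  whatever their weight. Every assignment is linked; an input sends flow only into the copy of its
  own assignment.\<close>

definition link_edges :: "(('a, 'v) nested_vertex \<times> ('a, 'v) nested_vertex) set" where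
  "link_edges = (\<lambda>(a, lam). (Walk T a, Inner a lam (lg_root (G a lam)))) ` (SIGMA a:V T. asg a)"

definition inner_edges :: "(('a, 'v) nested_vertex \<times> ('a, 'v) nested_vertex) set" where
  "inner_edges = (\<lambda>((a, lam), u, v). (Inner a lam u, Inner a lam v)) `
     (SIGMA (a, lam):(SIGMA a:V T. asg a). lg_edges (G a lam))"

definition all_edges :: "(('a, 'v) nested_vertex \<times> ('a, 'v) nested_vertex) set" where
  "all_edges = walk_edges \<union> link_edges \<union> inner_edges"

definition all_verts :: "('a, 'v) nested_vertex set" where
  "all_verts = (\<lambda>(t, a). Walk t a) ` (SIGMA t:{..T}. V t) \<union>
     (\<lambda>((a, lam), v). Inner a lam v) ` (SIGMA (a, lam):(SIGMA a:V T. asg a). lg_verts (G a lam))"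

text \<open>Keeping \<open>lab T a\<close> in the labels of a copy lets the weights there depend on
  whether the input matches \<open>lam\<close>, and lets certificates for the restricted function
  become certificates for \<open>f\<close>.\<close>

definition label :: "('a, 'v) nested_vertex \<Rightarrow> nat set" where
  "label v = (case v of Walk t a \<Rightarrow> lab t a | Inner a lam u \<Rightarrow> lab T a \<union> lg_label (G a lam) u)"

text \<open>
  The copies of inner graphs that belong to a wrong assignment need a positive weight \<open>\<epsilon>\<close> as well.
\<close>

definition weight ::
  "real \<Rightarrow> input \<Rightarrow> ('a, 'v) nested_vertex \<times> ('a, 'v) nested_vertex \<Rightarrow> real" where
  "weight \<epsilon> z e = (case e of
     (Walk t a, Walk t' b) \<Rightarrow> if gain t a b = 0 then 1 else kappa * real (gain t a b)
   | (Inner a lam u, Inner a' lam' v) \<Rightarrow>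
       if restrict z (lab T a) = lam then kappa * lg_weight (G a lam) z (u, v) else \<epsilon>
   | _ \<Rightarrow> 1)"

definition flow :: "input \<Rightarrow> ('a, 'v) nested_vertex \<times> ('a, 'v) nested_vertex \<Rightarrow> real" where
  "flow y e = (case e of
     (Walk t a, Walk t' b) \<Rightarrow> step y t a b
   | (Walk t a, Inner a' lam v) \<Rightarrow> if restrict y (lab T a) = lam then mass y T a else 0
   | (Inner a lam u, Inner a' lam' v) \<Rightarrow>
       if restrict y (lab T a) = lam then mass y T a * lg_flow (G a lam) y (u, v) else 0
   | _ \<Rightarrow> 0)"

definition nested_graph :: "real \<Rightarrow> ('a, 'v) nested_vertex learning_graph" where
  "nested_graph \<epsilon> = \<lparr>lg_verts = all_verts, lg_edges = all_edges, lg_root = Walk 0 rt,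
     lg_label = label, lg_weight = weight \<epsilon>, lg_flow = flow\<rparr>"

lemma nested_graph_simps [simp]:
  "lg_verts (nested_graph \<epsilon>) = all_verts" "lg_edges (nested_graph \<epsilon>) = all_edges"
  "lg_root (nested_graph \<epsilon>) = Walk 0 rt" "lg_label (nested_graph \<epsilon>) = label"
  "lg_weight (nested_graph \<epsilon>) = weight \<epsilon>" "lg_flow (nested_graph \<epsilon>) = flow"
  by (simp_all add: nested_graph_def)

lemma flow_inner:
  "flow y (map_prod (Inner a lam) (Inner a lam) e) =
    (if restrict y (lab T a) = lam then mass y T a else 0) * lg_flow (G a lam) y e"
  by (cases e) (simp add: flow_def)

lemma kappa_pos: "0 < kappa"
  using M_pos by (simp add: kappa_def)

lemma restrict_in_asg: "restrict y (lab T a) \<in> asg a"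
  by (auto simp: asg_def)

lemma inner_facts:
  assumes "a \<in> V T" "lam \<in> asg a"
  shows "finite (lg_verts (G a lam))" "finite (lg_edges (G a lam))" "acyclic (lg_edges (G a lam))"
    "lg_root (G a lam) \<in> lg_verts (G a lam)" "lg_label (G a lam) (lg_root (G a lam)) = {}"
    "v \<in> lg_verts (G a lam) \<Longrightarrow> lg_label (G a lam) v \<subseteq> {..<N}"
    "(u, v) \<in> lg_edges (G a lam) \<Longrightarrow> lg_label (G a lam) u \<subseteq> lg_label (G a lam) v"
    "(u, v) \<in> lg_edges (G a lam) \<Longrightarrow> u \<in> lg_verts (G a lam) \<and> v \<in> lg_verts (G a lam)"
    "z \<in> cube N \<Longrightarrow> restrict z (lab T a) = lam \<Longrightarrow> e \<in> lg_edges (G a lam) \<Longrightarrow> 0 < lg_weight (G a lam) z e"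
proof -
  note * = inner_graph[OF assms(1) assms(2)[unfolded asg_def]]
  show "finite (lg_edges (G a lam))" using * by (rule finite_lg_edges)
  note ** = *[unfolded adaptive_learning_graph_def]
  show "finite (lg_verts (G a lam))" "acyclic (lg_edges (G a lam))"
    "lg_root (G a lam) \<in> lg_verts (G a lam)" "lg_label (G a lam) (lg_root (G a lam)) = {}"
    "v \<in> lg_verts (G a lam) \<Longrightarrow> lg_label (G a lam) v \<subseteq> {..<N}"
    using ** by simp_all
  show "(u, v) \<in> lg_edges (G a lam) \<Longrightarrow> lg_label (G a lam) u \<subseteq> lg_label (G a lam) v"
    using ** by blast
  show "(u, v) \<in> lg_edges (G a lam) \<Longrightarrow> u \<in> lg_verts (G a lam) \<and> v \<in> lg_verts (G a lam)"
    using conjunct1[OF conjunct2[OF **]] by blast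
  show "z \<in> cube N \<Longrightarrow> restrict z (lab T a) = lam \<Longrightarrow> e \<in> lg_edges (G a lam) \<Longrightarrow> 0 < lg_weight (G a lam) z e"
    using ** by simp
qed

lemma finite_asg: "a \<in> V T \<Longrightarrow> finite (asg a)"
  unfolding asg_def using lab_sub[of T a] by (intro finite_PiE) (auto intro: finite_subset)

lemma finite_E: "t < T \<Longrightarrow> finite (E t)"
  using E_sub[of t] finite_V[of t] finite_V[of "Suc t"] by (meson Suc_leI finite_SigmaI finite_subset less_imp_le)

lemma finite_E_sections:
  assumes "t < T" shows "finite {b. (a, b) \<in> E t}" "finite {a. (a, b) \<in> E t}"
proof -
  have "{b. (a, b) \<in> E t} \<subseteq> snd ` E t" "{a. (a, b) \<in> E t} \<subseteq> fst ` E t" by force+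
  then show "finite {b. (a, b) \<in> E t}" "finite {a. (a, b) \<in> E t}"
    using finite_E[OF assms] by (auto intro: finite_subset)
qed

text \<open>Both complexities are sums over all edges; this separates walk, links and inner copies
  so that each can be estimated on its own.\<close>

lemma sum_all_edges:
  "(\<Sum>e\<in>all_edges. h e) = (\<Sum>t<T. \<Sum>(a, b)\<in>E t. h (Walk t a, Walk (Suc t) b)) +
     (\<Sum>a\<in>V T. \<Sum>lam\<in>asg a. h (Walk T a, Inner a lam (lg_root (G a lam)))) +
     (\<Sum>a\<in>V T. \<Sum>lam\<in>asg a. \<Sum>(u, v)\<in>lg_edges (G a lam). h (Inner a lam u, Inner a lam v))"
proof -
  have fin: "finite (SIGMA t:{..<T}. E t)" "finite (SIGMA a:V T. asg a)"
    "finite (SIGMA (a, lam):(SIGMA a:V T. asg a). lg_edges (G a lam))"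
    using finite_E finite_asg finite_V[of T] inner_facts(2) by (auto intro!: finite_SigmaI)
  have w: "sum h walk_edges = (\<Sum>t<T. \<Sum>(a, b)\<in>E t. h (Walk t a, Walk (Suc t) b))"
    unfolding walk_edges_def
    by (subst sum.reindex) (auto simp: inj_on_def sum.Sigma finite_E split_beta intro!: sum.cong)
  have l: "sum h link_edges = (\<Sum>a\<in>V T. \<Sum>lam\<in>asg a. h (Walk T a, Inner a lam (lg_root (G a lam))))"
    unfolding link_edges_def
    by (subst sum.reindex) (auto simp: inj_on_def sum.Sigma finite_V finite_asg split_beta intro!: sum.cong)
  have i: "sum h inner_edges = (\<Sum>a\<in>V T. \<Sum>lam\<in>asg a. \<Sum>(u, v)\<in>lg_edges (G a lam). h (Inner a lam u, Inner a lam v))"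
  proof -
    have "sum h inner_edges = (\<Sum>p\<in>(SIGMA (a, lam):(SIGMA a:V T. asg a). lg_edges (G a lam)).
        h (Inner (fst (fst p)) (snd (fst p)) (fst (snd p)), Inner (fst (fst p)) (snd (fst p)) (snd (snd p))))"
      unfolding inner_edges_def
      by (subst sum.reindex) (auto simp: inj_on_def intro!: sum.cong)
    also have "\<dots> = (\<Sum>q\<in>(SIGMA a:V T. asg a). \<Sum>e\<in>lg_edges (G (fst q) (snd q)).
        h (Inner (fst q) (snd q) (fst e), Inner (fst q) (snd q) (snd e)))"
      using fin(2) inner_facts(2) by (subst sum.Sigma) (auto simp: split_beta intro!: sum.cong)
    also have "\<dots> = (\<Sum>a\<in>V T. \<Sum>lam\<in>asg a. \<Sum>(u, v)\<in>lg_edges (G a lam). h (Inner a lam u, Inner a lam v))"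
      using finite_V finite_asg by (subst sum.Sigma) (auto simp: split_beta)
    finally show ?thesis .
  qed
  have fe: "finite walk_edges" "finite link_edges" "finite inner_edges"
    using fin unfolding walk_edges_def link_edges_def inner_edges_def by auto
  have "walk_edges \<inter> link_edges = {}" "(walk_edges \<union> link_edges) \<inter> inner_edges = {}"
    by (auto simp: walk_edges_def link_edges_def inner_edges_def)
  then show ?thesis
    unfolding all_edges_def using fe w l i by (simp add: sum.union_disjoint)
qed

section \<open>Edges at a given vertex\<close>

lemma all_edges_iff [simp]:
  "(Walk t a, Walk t' b) \<in> all_edges \<longleftrightarrow> t < T \<and> t' = Suc t \<and> (a, b) \<in> E t"
  "(Walk t a, Inner a' lam v) \<in> all_edges \<longleftrightarrow>
     t = T \<and> a' = a \<and> a \<in> V T \<and> lam \<in> asg a \<and> v = lg_root (G a lam)"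
  "(Inner a lam u, Walk t b) \<notin> all_edges"
  "(Inner a lam u, Inner a' lam' v) \<in> all_edges \<longleftrightarrow>
     a' = a \<and> lam' = lam \<and> a \<in> V T \<and> lam \<in> asg a \<and> (u, v) \<in> lg_edges (G a lam)"
  by (auto simp: all_edges_def walk_edges_def link_edges_def inner_edges_def image_iff Bex_def)

lemma all_verts_iff [simp]:
  "Walk t a \<in> all_verts \<longleftrightarrow> t \<le> T \<and> a \<in> V t"
  "Inner a lam v \<in> all_verts \<longleftrightarrow> a \<in> V T \<and> lam \<in> asg a \<and> v \<in> lg_verts (G a lam)"
  by (auto simp: all_verts_def image_iff Bex_def)

lemma out_walk:
  assumes "t < T"
  shows "{e \<in> all_edges. fst e = Walk t a} = (\<lambda>b. (Walk t a, Walk (Suc t) b)) ` {b. (a, b) \<in> E t}"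
proof (rule set_eqI)
  fix e show "e \<in> {e \<in> all_edges. fst e = Walk t a} \<longleftrightarrow>
      e \<in> (\<lambda>b. (Walk t a, Walk (Suc t) b)) ` {b. (a, b) \<in> E t}"
    using assms by (cases e; cases "snd e") auto
qed

lemma out_link:
  assumes "a \<in> V T"
  shows "{e \<in> all_edges. fst e = Walk T a} = (\<lambda>lam. (Walk T a, Inner a lam (lg_root (G a lam)))) ` asg a"
proof (rule set_eqI)
  fix e show "e \<in> {e \<in> all_edges. fst e = Walk T a} \<longleftrightarrow>
      e \<in> (\<lambda>lam. (Walk T a, Inner a lam (lg_root (G a lam)))) ` asg a"
    using assms by (cases e; cases "snd e") auto
qed

lemma in_walk:
  assumes "t < T"
  shows "{e \<in> all_edges. snd e = Walk (Suc t) b} = (\<lambda>a. (Walk t a, Walk (Suc t) b)) ` {a. (a, b) \<in> E t}"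
proof (rule set_eqI)
  fix e show "e \<in> {e \<in> all_edges. snd e = Walk (Suc t) b} \<longleftrightarrow>
      e \<in> (\<lambda>a. (Walk t a, Walk (Suc t) b)) ` {a. (a, b) \<in> E t}"
    using assms by (cases e; cases "fst e") auto
qed

lemma in_root: "{e \<in> all_edges. snd e = Walk 0 a} = {}"
proof -
  have "e \<notin> all_edges" if "snd e = Walk 0 a" for e
    using that by (cases e; cases "fst e") auto
  then show ?thesis by blast
qed

lemma out_inner:
  assumes "a \<in> V T" "lam \<in> asg a"
  shows "{e \<in> all_edges. fst e = Inner a lam u} =
    map_prod (Inner a lam) (Inner a lam) ` {e \<in> lg_edges (G a lam). fst e = u}"
proof (rule set_eqI)
  fix e show "e \<in> {e \<in> all_edges. fst e = Inner a lam u} \<longleftrightarrow>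
      e \<in> map_prod (Inner a lam) (Inner a lam) ` {e \<in> lg_edges (G a lam). fst e = u}"
    using assms by (cases e; cases "snd e") (auto simp: image_iff)
qed

lemma in_inner:
  assumes "a \<in> V T" "lam \<in> asg a"
  shows "{e \<in> all_edges. snd e = Inner a lam v} =
    map_prod (Inner a lam) (Inner a lam) ` {e \<in> lg_edges (G a lam). snd e = v} \<union>
    (if v = lg_root (G a lam) then {(Walk T a, Inner a lam v)} else {})"
proof (rule set_eqI)
  fix e show "e \<in> {e \<in> all_edges. snd e = Inner a lam v} \<longleftrightarrow>
      e \<in> map_prod (Inner a lam) (Inner a lam) ` {e \<in> lg_edges (G a lam). snd e = v} \<union>
        (if v = lg_root (G a lam) then {(Walk T a, Inner a lam v)} else {})"
    using assms by (cases e; cases "fst e") (auto simp: image_iff)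
qed

section \<open>The flow of a positive input\<close>

context
  fixes y assumes y: "y \<in> cube N" "f y"
begin

lemma mass_nonneg: "0 \<le> mass y t a"
  unfolding mass_def by (intro sum_nonneg P_nonneg[OF y]) auto

lemma step_nonneg: "0 \<le> step y t a b"
  unfolding step_def by (intro sum_nonneg P_nonneg[OF y]) auto

text \<open>By injectivity at most one sample point passes through \<open>a\<close> at a positive
  time. At time 0 the root has mass 1, so the restriction matters.\<close>

lemma mass_le:
  assumes "0 < t" "t \<le> T"
  shows "mass y t a \<le> M"
proof (cases "\<exists>w\<in>Om y. path y w t = a")
  case True
  then obtain w where "w \<in> Om y" "path y w t = a" by blast
  with path_inj[OF y assms] have "{w \<in> Om y. path y w t = a} = {w}"
    by (auto dest: inj_onD)
  with \<open>w \<in> Om y\<close> show ?thesis using P_le[OF y] by (simp add: mass_def)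
next
  case False
  then have "{w \<in> Om y. path y w t = a} = {}" by blast
  then show ?thesis using M_pos by (simp only: mass_def) simp
qed

text \<open>An edge is bounded through its head, which sits at a positive time; for edges leaving
  the root a bound through the tail would only give 1.\<close>

lemma step_le_mass: "step y t a b \<le> mass y (Suc t) b"
  unfolding step_def mass_def using finite_Om[OF y] P_nonneg[OF y] by (intro sum_mono2) auto

lemma path_in_V: "w \<in> Om y \<Longrightarrow> t \<le> T \<Longrightarrow> path y w t \<in> V t"
proof (cases t)
  case (Suc s)
  assume "w \<in> Om y" "t \<le> T"
  with Suc path_step[OF y, of w s] E_sub[of s] show ?thesis by auto
qed (simp add: path_0[OF y] V_0)

lemma sum_mass: "t \<le> T \<Longrightarrow> (\<Sum>a\<in>V t. mass y t a) = 1"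
  unfolding mass_def P_sum[OF y, symmetric]
  using finite_Om[OF y] finite_V path_in_V by (intro sum.group) auto

lemma sum_step_out:
  assumes "t < T" shows "(\<Sum>b | (a, b) \<in> E t. step y t a b) = mass y t a"
proof -
  note finite_E_sections(1)[OF assms, of a]
  moreover have "(\<lambda>w. path y w (Suc t)) ` {w \<in> Om y. path y w t = a} \<subseteq> {b. (a, b) \<in> E t}"
    using path_step[OF y] assms by auto
  ultimately have "(\<Sum>b | (a, b) \<in> E t. sum (P y) {w \<in> {w \<in> Om y. path y w t = a}. path y w (Suc t) = b}) =
      sum (P y) {w \<in> Om y. path y w t = a}"
    using finite_Om[OF y] by (intro sum.group) auto
  then show ?thesis by (simp add: step_def mass_def conj_assoc)
qed

lemma sum_step_in:
  assumes "t < T" shows "(\<Sum>a | (a, b) \<in> E t. step y t a b) = mass y (Suc t) b"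
proof -
  note finite_E_sections(2)[OF assms, of b]
  moreover have "(\<lambda>w. path y w t) ` {w \<in> Om y. path y w (Suc t) = b} \<subseteq> {a. (a, b) \<in> E t}"
    using path_step[OF y] assms by auto
  ultimately have "(\<Sum>a | (a, b) \<in> E t. sum (P y) {w \<in> {w \<in> Om y. path y w (Suc t) = b}. path y w t = a}) =
      sum (P y) {w \<in> Om y. path y w (Suc t) = b}"
    using finite_Om[OF y] by (intro sum.group) auto
  moreover have "{w \<in> {w \<in> Om y. path y w (Suc t) = b}. path y w t = a} =
      {w \<in> Om y. path y w t = a \<and> path y w (Suc t) = b}" for a by auto
  ultimately show ?thesis by (simp add: step_def mass_def)
qed

lemma sum_step: "t < T \<Longrightarrow> (\<Sum>(a, b)\<in>E t. step y t a b) = 1"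
proof -
  assume t: "t < T"
  have E: "E t = (SIGMA a:V t. {b. (a, b) \<in> E t})" using E_sub[OF t] by auto
  have "(\<Sum>(a, b)\<in>(SIGMA a:V t. {b. (a, b) \<in> E t}). step y t a b) =
      (\<Sum>a\<in>V t. \<Sum>b | (a, b) \<in> E t. step y t a b)"
  proof (rule sum.Sigma[symmetric])
    show "finite (V t)" using finite_V t by simp
    show "\<forall>a\<in>V t. finite {b. (a, b) \<in> E t}"
      using finite_E_sections(1)[OF t] by blast
  qed
  then show ?thesis using sum_step_out[OF t] sum_mass[of t] t E by simp
qed

lemma outflow_walk: "t < T \<Longrightarrow> outflow all_edges (flow y) (Walk t a) = mass y t a"
  unfolding outflow_def out_walk by (subst sum.reindex) (auto simp: inj_on_def flow_def sum_step_out)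

lemma outflow_link: "a \<in> V T \<Longrightarrow> outflow all_edges (flow y) (Walk T a) = mass y T a"
  unfolding outflow_def out_link
  by (subst sum.reindex) (auto simp: inj_on_def flow_def finite_asg restrict_in_asg)

lemma inflow_walk: "t < T \<Longrightarrow> inflow all_edges (flow y) (Walk (Suc t) b) = mass y (Suc t) b"
  unfolding inflow_def in_walk by (subst sum.reindex) (auto simp: inj_on_def flow_def sum_step_in)

lemma inflow_root: "inflow all_edges (flow y) (Walk 0 a) = 0"
  unfolding inflow_def in_root by simp

abbreviation amount :: "'a \<Rightarrow> input \<Rightarrow> real" where
  "amount a lam \<equiv> (if restrict y (lab T a) = lam then mass y T a else 0)"

lemma outflow_inner:
  assumes "a \<in> V T" "lam \<in> asg a"
  shows "outflow all_edges (flow y) (Inner a lam u) =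
    amount a lam * outflow (lg_edges (G a lam)) (lg_flow (G a lam) y) u"
proof -
  have "inj_on (map_prod (Inner a lam) (Inner a lam)) {e \<in> lg_edges (G a lam). fst e = u}"
    by (auto simp: inj_on_def)
  then show ?thesis
    unfolding outflow_def out_inner[OF assms] sum_distrib_left
    by (simp only: sum.reindex o_def flow_inner)
qed

text \<open>The additional unit at the inner root comes through the link edge. It balances the unit
  surplus that the inner flow has there.\<close>

lemma inflow_inner:
  assumes "a \<in> V T" "lam \<in> asg a"
  shows "inflow all_edges (flow y) (Inner a lam v) =
    amount a lam * (inflow (lg_edges (G a lam)) (lg_flow (G a lam) y) v +
      (if v = lg_root (G a lam) then 1 else 0))"
proof -
  let ?A = "map_prod (Inner a lam) (Inner a lam) ` {e \<in> lg_edges (G a lam). snd e = v}"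
  have "sum (flow y) ?A = amount a lam * inflow (lg_edges (G a lam)) (lg_flow (G a lam) y) v"
  proof -
    have "inj_on (map_prod (Inner a lam) (Inner a lam)) {e \<in> lg_edges (G a lam). snd e = v}"
      by (auto simp: inj_on_def)
    then show ?thesis
      unfolding inflow_def sum_distrib_left by (simp only: sum.reindex o_def flow_inner)
  qed
  moreover have "finite ?A" "(Walk T a, Inner a lam v) \<notin> ?A"
    using inner_facts(2)[OF assms] by auto
  ultimately show ?thesis
    unfolding inflow_def in_inner[OF assms]
    by (auto simp: flow_def distrib_left)
qed

text \<open>The walk delivers flow only to inner graphs whose function accepts \<open>y\<close>, and
  for exactly these inputs an inner flow is guaranteed.\<close>

lemma mass_end: "mass y T a \<noteq> 0 \<Longrightarrow> g a y"
proof (rule ccontr)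
  assume "mass y T a \<noteq> 0" "\<not> g a y"
  then have "{w \<in> Om y. path y w T = a} = {}" using path_end[OF y] by blast
  with \<open>mass y T a \<noteq> 0\<close> show False by (simp only: mass_def) simp
qed

lemma inner_flow:
  assumes "a \<in> V T" "mass y T a \<noteq> 0" "lam = restrict y (lab T a)"
  shows "unit_flow (lg_verts (G a lam)) (lg_edges (G a lam)) (lg_root (G a lam))
    {v \<in> lg_verts (G a lam). \<exists>S\<subseteq>lg_label (G a lam) v.
       one_certificate N {z \<in> cube N. restrict z (lab T a) = lam} (g a) y S}
    (lg_flow (G a lam) y)"
  using inner_graph[of a lam] mass_end[of a] assms y restrict_in_asg[of y a]
  unfolding adaptive_learning_graph_def asg_def by blast

text \<open>Nothing is known about \<open>lg_flow\<close> of an inner graph that rejects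
  \<open>y\<close>; there the factor in front of it is zero, hence the case distinction.\<close>

lemma flow_nonneg: "e \<in> all_edges \<Longrightarrow> 0 \<le> flow y e"
proof -
  assume e: "e \<in> all_edges"
  have *: "0 \<le> amount a lam * lg_flow (G a lam) y (u, v)"
    if "a \<in> V T" "(u, v) \<in> lg_edges (G a lam)" for a lam u v
  proof (cases "amount a lam = 0")
    case False
    then have "mass y T a \<noteq> 0" "lam = restrict y (lab T a)" by (auto split: if_splits)
    with inner_flow[OF that(1) this] that(2) mass_nonneg show ?thesis
      by (simp add: unit_flow_def)
  qed auto
  obtain p q where pq: "e = (p, q)" by fastforce
  show ?thesis
  proof (cases p)
    case (Walk t a)
    then show ?thesis using step_nonneg mass_nonneg by (cases q) (auto simp: flow_def pq)
  next
    case (Inner a lam u)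
    then show ?thesis using e *[of a u _ lam] by (cases q) (auto simp: flow_def pq)
  qed
qed

lemma nested_flow:
  "unit_flow all_verts all_edges (Walk 0 rt)
     {v \<in> all_verts. \<exists>S\<subseteq>label v. one_certificate N (cube N) f y S} (flow y)"
  unfolding unit_flow_def
proof (intro conjI ballI)
  show "0 \<le> flow y e" if "e \<in> all_edges" for e using that by (rule flow_nonneg)
  show "outflow all_edges (flow y) (Walk 0 rt) - inflow all_edges (flow y) (Walk 0 rt) = 1"
    using T_pos sum_mass[of 0] by (simp add: outflow_walk inflow_root V_0)
next
  fix v assume v: "v \<in> all_verts - {Walk 0 rt}"
  let ?S = "{v \<in> all_verts. \<exists>S\<subseteq>label v. one_certificate N (cube N) f y S}"
  let ?o = "outflow all_edges (flow y) v" and ?i = "inflow all_edges (flow y) v"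
  show "if v \<in> ?S then ?o \<le> ?i else ?o = ?i"
  proof (cases v)
    case (Walk t a)
    have va: "v \<in> all_verts" "v \<noteq> Walk 0 rt" using v by auto
    have t: "t \<le> T" "a \<in> V t" using va(1) by (simp_all add: Walk)
    have "t \<noteq> 0"
    proof
      assume "t = 0"
      with t(2) V_0 have "a = rt" by simp
      with va(2) Walk \<open>t = 0\<close> show False by simp
    qed
    then obtain s where s: "t = Suc s" by (cases t) auto
    then have "?i = mass y t a" using t s by (simp add: Walk inflow_walk)
    moreover have "?o = mass y t a"
      using t by (cases "t = T") (simp_all add: Walk outflow_link outflow_walk)
    ultimately show ?thesis by simp
  next
    case (Inner a lam u)
    have a: "a \<in> V T" "lam \<in> asg a" "u \<in> lg_verts (G a lam)" using v by (simp_all add: Inner)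
    let ?H = "G a lam"
    let ?oi = "outflow (lg_edges ?H) (lg_flow ?H y) u"
    let ?ii = "inflow (lg_edges ?H) (lg_flow ?H y) u"
    note oi = outflow_inner[OF a(1,2), of u] inflow_inner[OF a(1,2), of u]
    show ?thesis
    proof (cases "amount a lam = 0")
      case True
      then show ?thesis using oi by (simp add: Inner)
    next
      case False
      then have ne: "mass y T a \<noteq> 0" and lam: "lam = restrict y (lab T a)" by (auto split: if_splits)
      note fl = inner_flow[OF a(1) ne lam, unfolded unit_flow_def]
      \<comment> \<open>At the inner root the surplus of the inner flow is matched by the link edge;
        at every other vertex conservation, or the inequality at a sink, is inherited after scaling
        by the mass.\<close>
      show ?thesis
      proof (cases "u = lg_root ?H")
        case True
        then have "?oi = ?ii + 1" using fl by simp
        then show ?thesis using oi True by (simp add: Inner)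
      next
        case nroot: False
        show ?thesis
        proof (cases "\<exists>S\<subseteq>lg_label ?H u. one_certificate N {z \<in> cube N. restrict z (lab T a) = lam} (g a) y S")
          case True
          then obtain S where S: "S \<subseteq> lg_label ?H u"
            "one_certificate N {z \<in> cube N. restrict z (lab T a) = lam} (g a) y S" by blast
          \<comment> \<open>An input that agrees with \<open>y\<close> on \<open>lab T a\<close>
            lies in the subdomain of \<open>lam\<close>; there \<open>S\<close> certifies
            \<open>g a\<close>, which implies \<open>f\<close>.\<close>
          have "one_certificate N (cube N) f y (lab T a \<union> S)"
            unfolding one_certificate_def
          proof (intro conjI ballI impI)
            show "lab T a \<union> S \<subseteq> {..<N}"
              using S(2) lab_sub[of T a] a unfolding one_certificate_def by auto
            fix z assume z: "z \<in> cube N" "restrict z (lab T a \<union> S) = restrict y (lab T a \<union> S)"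
            then have "restrict z (lab T a) = lam" "restrict z S = restrict y S"
              unfolding lam by (auto intro: restrict_eq_subset)
            then show "f z"
              using S(2) z(1) g_imp_f[OF a(1)] unfolding one_certificate_def by blast
          qed
          moreover have "lab T a \<union> S \<subseteq> label v" using S(1) by (auto simp: label_def Inner)
          ultimately have "v \<in> ?S" using v by blast
          moreover have "?oi \<le> ?ii" using fl True nroot a(3) by simp
          ultimately show ?thesis
            using oi nroot mass_nonneg[of T a] by (simp add: Inner mult_left_mono)
        next
          case False
          then have "?oi = ?ii" using fl nroot a(3) by simp
          then show ?thesis using oi nroot by (simp add: Inner)
        qed
      qed
    qed
  qed
qed

end

section \<open>The defining conditions of a learning graph\<close>

lemma acyclic_all_edges: "acyclic all_edges"
proof -
  \<comment> \<open>Invariant of nonempty paths: time increases along the walk, no path leaves a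
    copy once it has entered it, and inside a copy the path is one of the inner graph.\<close>
  have *: "(case p of Walk t a \<Rightarrow> (case q of Walk t' b \<Rightarrow> t < t' | Inner _ _ _ \<Rightarrow> True)
     | Inner a lam u \<Rightarrow> (case q of Walk _ _ \<Rightarrow> False
         | Inner a' lam' v \<Rightarrow> a' = a \<and> lam' = lam \<and> a \<in> V T \<and> lam \<in> asg a \<and> (u, v) \<in> (lg_edges (G a lam))\<^sup>+))"
    if "(p, q) \<in> all_edges\<^sup>+" for p q
    using that
  proof (induction rule: trancl_induct)
    case (base q)
    then show ?case by (cases p; cases q) auto
  next
    case (step q s)
    from step.hyps(2) step.IH show ?case
      by (cases p; cases q; cases s) (auto intro: trancl_into_trancl)
  qed
  show ?thesis
    unfolding acyclic_def
  proof
    fix p :: "('a, 'v) nested_vertex"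
    show "(p, p) \<notin> all_edges\<^sup>+"
    proof
      assume "(p, p) \<in> all_edges\<^sup>+"
      from *[OF this] inner_facts(3) show False by (cases p) (auto simp: acyclic_def)
    qed
  qed
qed

lemma all_edges_cases [consumes 1]:
  assumes "e \<in> all_edges"
  obtains t a b where "e = (Walk t a, Walk (Suc t) b)" "t < T" "(a, b) \<in> E t"
    | a lam where "e = (Walk T a, Inner a lam (lg_root (G a lam)))" "a \<in> V T" "lam \<in> asg a"
    | a lam u v where "e = (Inner a lam u, Inner a lam v)" "a \<in> V T" "lam \<in> asg a" "(u, v) \<in> lg_edges (G a lam)"
  using assms by (cases e; cases "fst e"; cases "snd e") auto

lemma nested_graph_alg:
  assumes "0 < \<epsilon>"
  shows "adaptive_learning_graph N (cube N) f (nested_graph \<epsilon>)"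
  unfolding adaptive_learning_graph_def nested_graph_simps
proof (intro conjI)
  show "finite all_verts"
    unfolding all_verts_def
    using finite_asg finite_V inner_facts(1) by (auto intro!: finite_SigmaI)
  show "all_edges \<subseteq> all_verts \<times> all_verts"
  proof
    fix e assume "e \<in> all_edges"
    then show "e \<in> all_verts \<times> all_verts"
    proof (cases rule: all_edges_cases)
      case (1 t a b)
      then show ?thesis using E_sub[of t] by auto
    next
      case 2
      then show ?thesis using inner_facts(4) by simp
    next
      case 3
      then show ?thesis using inner_facts(8)[OF 3(2-4)] by simp
    qed
  qed
  show "acyclic all_edges" by (rule acyclic_all_edges)
  show "\<forall>v\<in>all_verts. label v \<subseteq> {..<N}"
  proof
    fix v assume "v \<in> all_verts"
    then show "label v \<subseteq> {..<N}"
      using lab_sub[of T] lab_sub inner_facts(6) by (cases v) (simp_all add: label_def)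
  qed
  show "Walk 0 rt \<in> all_verts" using V_0 by simp
  show "label (Walk 0 rt) = {}" by (simp add: label_def lab_0)
  show "\<forall>(u, v)\<in>all_edges. label u \<subseteq> label v"
  proof (clarify)
    fix p q i assume "(p, q) \<in> all_edges" "i \<in> label p"
    then show "i \<in> label q"
    proof (cases rule: all_edges_cases)
      case 3
      with inner_facts(7)[OF 3(2-4)] \<open>i \<in> label p\<close> show ?thesis by (auto simp: label_def)
    qed (use lab_mono \<open>i \<in> label p\<close> in \<open>auto simp: label_def\<close>)
  qed
  show "\<forall>z\<in>cube N. \<forall>e\<in>all_edges. 0 < weight \<epsilon> z e"
  proof (intro ballI)
    fix z e assume z: "z \<in> cube N" and "e \<in> all_edges"
    then show "0 < weight \<epsilon> z e"
    proof (cases rule: all_edges_cases[OF \<open>e \<in> all_edges\<close>])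
      case 3
      with inner_facts(9)[OF 3(2,3) z _ 3(4)] assms kappa_pos show ?thesis by (simp add: weight_def)
    qed (use kappa_pos in \<open>auto simp: weight_def\<close>)
  qed
  show "\<forall>(u, v)\<in>all_edges. \<forall>z\<in>cube N. \<forall>z'\<in>cube N.
       restrict z (label v) = restrict z' (label v) \<longrightarrow> weight \<epsilon> z (u, v) = weight \<epsilon> z' (u, v)"
  proof (clarify)
    fix p q z z' assume *: "(p, q) \<in> all_edges" "z \<in> cube N" "z' \<in> cube N"
      "restrict z (label q) = restrict z' (label q)"
    show "weight \<epsilon> z (p, q) = weight \<epsilon> z' (p, q)"
    proof (cases rule: all_edges_cases[OF *(1)])
      case (3 a lam u v)
      \<comment> \<open>The label of the head contains \<open>lab T a\<close>, so both inputs fall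
        into the same case of \<open>weight\<close>. The inner locality condition speaks only about
        inputs matching \<open>lam\<close>, hence the distinction below.\<close>
      have 1: "restrict z (lab T a) = restrict z' (lab T a)"
        by (rule restrict_eq_subset[OF *(4)]) (use 3 in \<open>simp add: label_def\<close>)
      have 2: "restrict z (lg_label (G a lam) v) = restrict z' (lg_label (G a lam) v)"
        by (rule restrict_eq_subset[OF *(4)]) (use 3 in \<open>simp add: label_def\<close>)
      show ?thesis
      proof (cases "restrict z (lab T a) = lam")
        case True
        have "lg_weight (G a lam) z (u, v) = lg_weight (G a lam) z' (u, v)"
          by (rule learning_graph_weight_local[OF inner_graph[OF 3(2) 3(3)[unfolded asg_def]] 3(4) _ _ 2])
            (use True 1 * in auto)
        then show ?thesis using 1 by (simp add: weight_def 3)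
      qed (use 1 3 in \<open>simp add: weight_def\<close>)
    qed (simp_all add: weight_def)
  qed
  show "\<forall>y\<in>cube N. f y \<longrightarrow> unit_flow all_verts all_edges (Walk 0 rt)
      {v \<in> all_verts. \<exists>S\<subseteq>label v. one_certificate N (cube N) f y S} (flow y)"
    using nested_flow by blast
qed

section \<open>Edge lengths and the two complexities\<close>

lemma edge_length_walk:
  "edge_length (nested_graph \<epsilon>) (Walk t a, Walk (Suc t) b) = gain t a b"
  by (simp add: edge_length_def label_def gain_def)

lemma edge_length_link:
  assumes "a \<in> V T" "lam \<in> asg a"
  shows "edge_length (nested_graph \<epsilon>) (Walk T a, Inner a lam (lg_root (G a lam))) = 0"
  using inner_facts(5)[OF assms] by (simp add: edge_length_def label_def)

text \<open>Only an inequality, because an inner graph may query coordinates that the walk has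
  already loaded.\<close>

lemma edge_length_inner:
  assumes "a \<in> V T" "lam \<in> asg a" "(u, v) \<in> lg_edges (G a lam)"
  shows "edge_length (nested_graph \<epsilon>) (Inner a lam u, Inner a lam v) \<le> edge_length (G a lam) (u, v)"
proof -
  have "finite (lg_label (G a lam) v)"
    using inner_facts(6)[OF assms(1,2), of v] inner_facts(8)[OF assms] finite_subset by blast
  then show ?thesis
    by (auto simp: edge_length_def label_def intro!: card_mono)
qed

text \<open>For a given input one copy per final state has its genuine weights. All other copies
  together cost at most \<open>\<epsilon>\<close> times a quantity that does not depend on the
  input.\<close>

lemma nested_graph_C0:
  assumes x: "x \<in> cube N" and \<epsilon>: "0 < \<epsilon>"
  shows "C0 (nested_graph \<epsilon>) x \<le>
    kappa * ((\<Sum>t<T. \<Sum>(a, b)\<in>E t. (real (gain t a b))\<^sup>2) +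
             (\<Sum>a\<in>V T. C0 (G a (restrict x (lab T a))) x)) +
    \<epsilon> * (\<Sum>a\<in>V T. \<Sum>lam\<in>asg a. \<Sum>e\<in>lg_edges (G a lam). real (edge_length (G a lam) e))"
proof -
  let ?H = "nested_graph \<epsilon>"
  let ?h = "\<lambda>e. real (edge_length ?H e) * weight \<epsilon> x e"
  \<comment> \<open>An edge without gain has length zero, so its weight 1 does not count; otherwise
    length times weight is \<open>kappa\<close> times the squared gain.\<close>
  have w: "(\<Sum>t<T. \<Sum>(a, b)\<in>E t. ?h (Walk t a, Walk (Suc t) b)) =
      kappa * (\<Sum>t<T. \<Sum>(a, b)\<in>E t. (real (gain t a b))\<^sup>2)"
    unfolding sum_distrib_left
    by (intro sum.cong) (auto simp: edge_length_walk weight_def power2_eq_square)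
  have l: "(\<Sum>a\<in>V T. \<Sum>lam\<in>asg a. ?h (Walk T a, Inner a lam (lg_root (G a lam)))) = 0"
    by (intro sum.neutral ballI) (simp add: edge_length_link)
  have i: "(\<Sum>lam\<in>asg a. \<Sum>(u, v)\<in>lg_edges (G a lam). ?h (Inner a lam u, Inner a lam v)) \<le>
      kappa * C0 (G a (restrict x (lab T a))) x +
      \<epsilon> * (\<Sum>lam\<in>asg a. \<Sum>e\<in>lg_edges (G a lam). real (edge_length (G a lam) e))" (is "?L \<le> _")
    if a: "a \<in> V T" for a
  proof -
    let ?D = "restrict x (lab T a)"
    have "(\<Sum>(u, v)\<in>lg_edges (G a lam). ?h (Inner a lam u, Inner a lam v)) \<le>
        (if lam = ?D then kappa * C0 (G a lam) x else 0) +
        \<epsilon> * (\<Sum>e\<in>lg_edges (G a lam). real (edge_length (G a lam) e))" if lam: "lam \<in> asg a" for lam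
    proof (cases "lam = ?D")
      case True
      have "(\<Sum>(u, v)\<in>lg_edges (G a lam). ?h (Inner a lam u, Inner a lam v)) \<le>
          (\<Sum>e\<in>lg_edges (G a lam). kappa * (real (edge_length (G a lam) e) * lg_weight (G a lam) x e))"
      proof (intro sum_mono, clarify)
        fix u v assume e: "(u, v) \<in> lg_edges (G a lam)"
        have "0 < lg_weight (G a lam) x (u, v)" using inner_facts(9)[OF a lam x _ e] True by simp
        then show "?h (Inner a lam u, Inner a lam v) \<le>
            kappa * (real (edge_length (G a lam) (u, v)) * lg_weight (G a lam) x (u, v))"
          using edge_length_inner[OF a lam e] True kappa_pos by (simp add: weight_def mult_left_mono)
      qed
      also have "\<dots> = kappa * C0 (G a lam) x" by (simp add: C0_def sum_distrib_left)
      also have "\<dots> \<le> kappa * C0 (G a lam) x + \<epsilon> * (\<Sum>e\<in>lg_edges (G a lam). real (edge_length (G a lam) e))"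
        using \<epsilon> by (simp add: sum_nonneg)
      finally show ?thesis using True by simp
    next
      case False
      have "(\<Sum>(u, v)\<in>lg_edges (G a lam). ?h (Inner a lam u, Inner a lam v)) \<le>
          (\<Sum>e\<in>lg_edges (G a lam). \<epsilon> * real (edge_length (G a lam) e))"
      proof (intro sum_mono, clarify)
        fix u v assume e: "(u, v) \<in> lg_edges (G a lam)"
        then show "?h (Inner a lam u, Inner a lam v) \<le> \<epsilon> * real (edge_length (G a lam) (u, v))"
          using edge_length_inner[OF a lam e] False \<epsilon> by (auto simp: weight_def)
      qed
      then show ?thesis using False by (simp add: sum_distrib_left)
    qed
    then have "?L \<le> (\<Sum>lam\<in>asg a. (if lam = ?D then kappa * C0 (G a lam) x else 0) +
        \<epsilon> * (\<Sum>e\<in>lg_edges (G a lam). real (edge_length (G a lam) e)))"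
      by (rule sum_mono)
    also have "\<dots> = kappa * C0 (G a ?D) x +
        \<epsilon> * (\<Sum>lam\<in>asg a. \<Sum>e\<in>lg_edges (G a lam). real (edge_length (G a lam) e))"
      using finite_asg[OF a] restrict_in_asg by (simp add: sum.distrib sum_distrib_left)
    finally show ?thesis .
  qed
  have "C0 ?H x = (\<Sum>e\<in>all_edges. ?h e)" by (simp add: C0_def)
  also have "\<dots> \<le> kappa * (\<Sum>t<T. \<Sum>(a, b)\<in>E t. (real (gain t a b))\<^sup>2) + 0 +
      (\<Sum>a\<in>V T. kappa * C0 (G a (restrict x (lab T a))) x +
         \<epsilon> * (\<Sum>lam\<in>asg a. \<Sum>e\<in>lg_edges (G a lam). real (edge_length (G a lam) e)))"
    unfolding sum_all_edges w l by (intro add_mono order_refl sum_mono i)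
  also have "\<dots> = kappa * ((\<Sum>t<T. \<Sum>(a, b)\<in>E t. (real (gain t a b))\<^sup>2) +
             (\<Sum>a\<in>V T. C0 (G a (restrict x (lab T a))) x)) +
      \<epsilon> * (\<Sum>a\<in>V T. \<Sum>lam\<in>asg a. \<Sum>e\<in>lg_edges (G a lam). real (edge_length (G a lam) e))"
    by (simp add: sum.distrib sum_distrib_left distrib_left)
  finally show ?thesis .
qed

lemma nested_graph_C1:
  assumes y: "y \<in> cube N" "f y"
  shows "C1 (nested_graph \<epsilon>) y \<le> 1"
proof -
  let ?H = "nested_graph \<epsilon>"
  let ?h = "\<lambda>e. real (edge_length ?H e) * (flow y e)\<^sup>2 / weight \<epsilon> y e"
  \<comment> \<open>One factor of the squared flow is replaced by the bound \<open>M\<close>; the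
    remaining factors sum to at most 1 over a layer.\<close>
  have sq: "p\<^sup>2 / kappa \<le> p * (M / kappa)" if "0 \<le> p" "p \<le> M" for p
    using that kappa_pos by (simp add: power2_eq_square divide_simps mult_left_mono)
  have w: "(\<Sum>(a, b)\<in>E t. ?h (Walk t a, Walk (Suc t) b)) \<le> M / kappa" if t: "t < T" for t
  proof -
    have "(\<Sum>(a, b)\<in>E t. ?h (Walk t a, Walk (Suc t) b)) \<le> (\<Sum>(a, b)\<in>E t. step y t a b * (M / kappa))"
    proof (intro sum_mono, clarify)
      fix a b
      have p: "0 \<le> step y t a b" "step y t a b \<le> M"
        using step_nonneg[OF y] step_le_mass[OF y, of t a b] mass_le[OF y, of "Suc t" b] t by auto
      \<comment> \<open>Length divided by weight is either \<open>1 / kappa\<close> or, without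
        gain, zero.\<close>
      have "?h (Walk t a, Walk (Suc t) b) \<le> (step y t a b)\<^sup>2 / kappa"
        using kappa_pos by (simp add: edge_length_walk weight_def flow_def)
      also have "\<dots> \<le> step y t a b * (M / kappa)" by (rule sq[OF p])
      finally show "?h (Walk t a, Walk (Suc t) b) \<le> step y t a b * (M / kappa)" .
    qed
    also have "\<dots> = (\<Sum>(a, b)\<in>E t. step y t a b) * (M / kappa)"
      unfolding sum_distrib_right by (simp only: case_prod_unfold)
    finally show ?thesis using sum_step[OF y t] by simp
  qed
  have l: "(\<Sum>a\<in>V T. \<Sum>lam\<in>asg a. ?h (Walk T a, Inner a lam (lg_root (G a lam)))) = 0"
    by (intro sum.neutral ballI) (simp add: edge_length_link)
  have i: "(\<Sum>lam\<in>asg a. \<Sum>(u, v)\<in>lg_edges (G a lam). ?h (Inner a lam u, Inner a lam v)) \<le>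
      mass y T a * (M / kappa)" (is "?L \<le> _") if a: "a \<in> V T" for a
  proof -
    let ?D = "restrict y (lab T a)" and ?q = "mass y T a"
    have q: "0 \<le> ?q" "?q \<le> M" using mass_nonneg[OF y] mass_le[OF y, of T] T_pos by auto
    have "(\<Sum>(u, v)\<in>lg_edges (G a lam). ?h (Inner a lam u, Inner a lam v)) \<le>
        (if lam = ?D then ?q\<^sup>2 / kappa * C1 (G a lam) y else 0)" if lam: "lam \<in> asg a" for lam
    proof (cases "lam = ?D")
      case True
      have "(\<Sum>(u, v)\<in>lg_edges (G a lam). ?h (Inner a lam u, Inner a lam v)) \<le>
          (\<Sum>e\<in>lg_edges (G a lam). ?q\<^sup>2 / kappa *
             (real (edge_length (G a lam) e) * (lg_flow (G a lam) y e)\<^sup>2 / lg_weight (G a lam) y e))"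
      proof (intro sum_mono, clarify)
        fix u v assume e: "(u, v) \<in> lg_edges (G a lam)"
        let ?w = "lg_weight (G a lam) y (u, v)" and ?p = "lg_flow (G a lam) y (u, v)"
        have "0 < ?w" using inner_facts(9)[OF a lam y(1) _ e] True by simp
        then have "0 \<le> (?q * ?p)\<^sup>2 / (kappa * ?w)" using kappa_pos by simp
        from mult_right_mono[OF _ this]
        have "?h (Inner a lam u, Inner a lam v) \<le>
            real (edge_length (G a lam) (u, v)) * ((?q * ?p)\<^sup>2 / (kappa * ?w))"
          using edge_length_inner[OF a lam e] True by (simp add: weight_def flow_def)
        also have "\<dots> = ?q\<^sup>2 / kappa * (real (edge_length (G a lam) (u, v)) * ?p\<^sup>2 / ?w)"
          by (simp add: power_mult_distrib)
        finally show "?h (Inner a lam u, Inner a lam v) \<le>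
            ?q\<^sup>2 / kappa * (real (edge_length (G a lam) (u, v)) * ?p\<^sup>2 / ?w)" .
      qed
      then show ?thesis using True by (simp add: C1_def sum_distrib_left)
    next
      case False
      have "(\<Sum>(u, v)\<in>lg_edges (G a lam). ?h (Inner a lam u, Inner a lam v)) = 0"
        using False by (intro sum.neutral) (auto simp: flow_def)
      then show ?thesis using False by simp
    qed
    then have "?L \<le> (\<Sum>lam\<in>asg a. if lam = ?D then ?q\<^sup>2 / kappa * C1 (G a lam) y else 0)"
      by (rule sum_mono)
    also have "\<dots> = ?q\<^sup>2 / kappa * C1 (G a ?D) y"
      using finite_asg[OF a] restrict_in_asg by simp
    \<comment> \<open>The bound on the inner \<open>C1\<close> is available only if
      \<open>g a\<close> accepts \<open>y\<close>; a state that rejects \<open>y\<close> has mass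
      zero.\<close>
    also have "\<dots> \<le> ?q\<^sup>2 / kappa"
    proof (cases "?q = 0")
      case False
      then have "C1 (G a ?D) y \<le> 1" using mass_end[OF y False] inner_C1[OF a y(1)] by simp
      from mult_left_mono[OF this, of "?q\<^sup>2 / kappa"] kappa_pos show ?thesis by simp
    qed simp
    also have "\<dots> \<le> ?q * (M / kappa)" by (rule sq[OF q])
    finally show ?thesis .
  qed
  have "C1 ?H y = (\<Sum>e\<in>all_edges. ?h e)" by (simp add: C1_def)
  also have "\<dots> \<le> (\<Sum>t<T. M / kappa) + 0 + (\<Sum>a\<in>V T. mass y T a * (M / kappa))"
    unfolding sum_all_edges l by (intro add_mono order_refl sum_mono i w) auto
  also have "(\<Sum>a\<in>V T. mass y T a * (M / kappa)) = M / kappa"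
    unfolding sum_distrib_right[symmetric] using sum_mass[OF y, of T] by simp
  also have "(\<Sum>t<T. M / kappa) + 0 + M / kappa = (real T * M + M) / kappa"
    by (simp add: add_divide_distrib)
  also have "real T * M + M = kappa" by (simp add: kappa_def algebra_simps)
  also have "kappa / kappa = 1" using kappa_pos by simp
  finally show ?thesis .
qed

theorem nested_walk_graph:
  assumes "0 < \<delta>"
  shows "\<exists>H :: ('a, 'v) nested_vertex learning_graph.
    adaptive_learning_graph N (cube N) f H \<and> (\<forall>y\<in>cube N. f y \<longrightarrow> C1 H y \<le> 1) \<and>
    (\<forall>x\<in>cube N. C0 H x \<le> real (T + 1) * M *
      ((\<Sum>t<T. \<Sum>(a, b)\<in>E t. (real (card (lab (Suc t) b - lab t a)))\<^sup>2) +
       (\<Sum>a\<in>V T. C0 (G a (restrict x (lab T a))) x)) + \<delta>)"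
proof -
  \<comment> \<open>The total length of all inner copies bounds what the copies with a wrong
    assignment can cost per unit of \<open>\<epsilon>\<close>.\<close>
  define B where "B = (\<Sum>a\<in>V T. \<Sum>lam\<in>asg a. \<Sum>e\<in>lg_edges (G a lam). real (edge_length (G a lam) e))"
  define \<epsilon> where "\<epsilon> = \<delta> / (1 + B)"
  have B: "0 \<le> B" unfolding B_def by (intro sum_nonneg) simp
  have \<epsilon>: "0 < \<epsilon>" "\<epsilon> * B \<le> \<delta>" using B assms by (auto simp: \<epsilon>_def field_simps)
  have "C0 (nested_graph \<epsilon>) x \<le> real (T + 1) * M *
      ((\<Sum>t<T. \<Sum>(a, b)\<in>E t. (real (card (lab (Suc t) b - lab t a)))\<^sup>2) +
       (\<Sum>a\<in>V T. C0 (G a (restrict x (lab T a))) x)) + \<delta>" if "x \<in> cube N" for x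
    using nested_graph_C0[OF that \<epsilon>(1)] \<epsilon>(2) unfolding B_def[symmetric] kappa_def gain_def by linarith
  then show ?thesis
    using nested_graph_alg[OF \<epsilon>(1)] nested_graph_C1 by blast
qed

end

section \<open>Counting partial subsets\<close>

lemma partial_subsets_iff:
  "A \<in> partial_subsets X k \<longleftrightarrow> length A = k \<and> (\<forall>i<k. \<forall>x. A ! i = Some x \<longrightarrow> x \<in> X) \<and>
     (\<forall>i<k. \<forall>j<k. \<forall>x. A ! i = Some x \<longrightarrow> A ! j = Some x \<longrightarrow> i = j)"
proof -
  have "b \<in> insert None (Some ` X) \<longleftrightarrow> (\<forall>x. b = Some x \<longrightarrow> x \<in> X)" for b
    by (cases b) auto
  then have "set A \<subseteq> insert None (Some ` X) \<longleftrightarrow> (\<forall>i<length A. \<forall>x. A ! i = Some x \<longrightarrow> x \<in> X)"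
    unfolding subset_eq all_set_conv_all_nth by blast
  moreover have "(\<forall>i<k. \<forall>j<k. i \<noteq> j \<and> A ! i = A ! j \<longrightarrow> A ! i = None) \<longleftrightarrow>
      (\<forall>i<k. \<forall>j<k. \<forall>x. A ! i = Some x \<longrightarrow> A ! j = Some x \<longrightarrow> i = j)"
    by (metis not_None_eq)
  ultimately show ?thesis unfolding partial_subsets_def by auto
qed

lemma finite_partial_subsets: "finite X \<Longrightarrow> finite (partial_subsets X k)"
  by (rule finite_subset[OF _ finite_lists_length_eq[of "insert None (Some ` X)" k]])
    (auto simp: partial_subsets_def)

lemma layer_partial: "A \<in> layer n k h \<Longrightarrow> A \<in> partial_subsets {..<n} k"
  by (simp add: layer_def)

lemma finite_layer: "finite (layer n k h)"
  unfolding layer_def using finite_partial_subsets[of "{..<n}" k] by simp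

lemma length_layer: "A \<in> layer n k h \<Longrightarrow> length A = k"
  by (simp add: layer_def partial_subsets_iff)

lemma elems_iff: "x \<in> elems A \<longleftrightarrow> (\<exists>i<length A. A ! i = Some x)"
  by (auto simp: elems_def in_set_conv_nth)

lemma elems_layer: "A \<in> layer n k h \<Longrightarrow> elems A \<subseteq> {..<n}"
  by (auto simp: elems_iff layer_def partial_subsets_iff)

lemma card_elems:
  assumes "A \<in> layer n k h" shows "card (elems A) = h"
proof -
  have A: "A \<in> partial_subsets {..<n} k" and h: "card {i. i < length A \<and> A ! i \<noteq> None} = h"
    using assms by (auto simp: layer_def filled_def)
  have "elems A = (\<lambda>i. the (A ! i)) ` {i. i < length A \<and> A ! i \<noteq> None}"
    by (force simp: elems_iff)
  moreover have "inj_on (\<lambda>i. the (A ! i)) {i. i < length A \<and> A ! i \<noteq> None}"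
    using A by (auto simp: inj_on_def partial_subsets_iff)
  ultimately show ?thesis using h card_image by fastforce
qed

lemma finite_elems [simp]: "finite (elems A)"
proof -
  have "elems A \<subseteq> the ` set A" by (force simp: elems_def)
  then show ?thesis using finite_subset by blast
qed

lemma filled_stars: "filled A + card (stars A) = length A"
proof -
  have "filled A + card (stars A) = card ({i. i < length A \<and> A ! i \<noteq> None} \<union> stars A)"
    unfolding filled_def by (subst card_Un_disjoint) (auto simp: stars_def)
  also have "{i. i < length A \<and> A ! i \<noteq> None} \<union> stars A = {..<length A}"
    by (auto simp: stars_def)
  finally show ?thesis by simp
qed

lemma finite_stars [simp]: "finite (stars A)"
  by (simp add: stars_def)

lemma card_stars: "A \<in> layer n k h \<Longrightarrow> card (stars A) = k - h"
  using filled_stars[of A] length_layer[of A n k h] by (simp add: layer_def)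

lemma elems_update:
  assumes "p \<in> stars A" shows "elems (A[p := Some v]) = insert v (elems A)"
proof (rule set_eqI)
  fix x
  have p: "p < length A" "A ! p = None" using assms by (auto simp: stars_def)
  have "x \<in> elems (A[p := Some v])" if x: "x \<in> insert v (elems A)"
  proof (cases "x = v")
    case True
    then show ?thesis using p by (auto simp: elems_iff intro!: exI[of _ p])
  next
    case False
    then obtain i where i: "i < length A" "A ! i = Some x" using x by (auto simp: elems_iff)
    then have "i \<noteq> p" using p by auto
    then show ?thesis using i by (auto simp: elems_iff intro!: exI[of _ i])
  qed
  moreover have "x \<in> insert v (elems A)" if x: "x \<in> elems (A[p := Some v])"
  proof -
    obtain i where i: "i < length A" "A[p := Some v] ! i = Some x" using x by (auto simp: elems_iff)
    then show ?thesis using p by (cases "i = p") (auto simp: elems_iff)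
  qed
  ultimately show "x \<in> elems (A[p := Some v]) \<longleftrightarrow> x \<in> insert v (elems A)" by blast
qed

lemma stars_update: "p \<in> stars A \<Longrightarrow> stars (A[p := Some v]) = stars A - {p}"
  by (auto simp: stars_def nth_list_update split: if_splits)

lemma layer_update:
  assumes A: "A \<in> layer n k h" and v: "v < n" "v \<notin> elems A" and p: "p \<in> stars A"
  shows "A[p := Some v] \<in> layer n k (Suc h)"
proof -
  have "A[p := Some v] \<in> partial_subsets {..<n} k"
    using A v p unfolding layer_def partial_subsets_iff elems_iff stars_def
    by (auto simp: nth_list_update)
  moreover have "filled (A[p := Some v]) = Suc h"
  proof -
    have "card (stars A) > 0" using p by (auto simp: card_gt_0_iff)
    then show ?thesis
      using filled_stars[of "A[p := Some v]"] filled_stars[of A] A p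
      by (simp add: stars_update layer_def)
  qed
  ultimately show ?thesis by (simp add: layer_def)
qed

lemma layer_erase:
  assumes B: "B \<in> layer n k (Suc h)" and p: "p < k" "B ! p = Some v"
  shows "B[p := None] \<in> layer n k h" "v \<notin> elems (B[p := None])" "p \<in> stars (B[p := None])"
proof -
  have len: "length B = k" using B by (rule length_layer)
  have st: "stars (B[p := None]) = insert p (stars B)" "p \<notin> stars B"
    using p len by (auto simp: stars_def nth_list_update)
  have "filled (B[p := None]) = h"
    using filled_stars[of "B[p := None]"] filled_stars[of B] B st by (simp add: layer_def)
  moreover have "B[p := None] \<in> partial_subsets {..<n} k"
    using B p unfolding layer_def partial_subsets_iff by (auto simp: nth_list_update split: if_splits)
  ultimately show "B[p := None] \<in> layer n k h" by (simp add: layer_def)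
  show "v \<notin> elems (B[p := None])"
    using B p unfolding layer_def partial_subsets_iff elems_iff by (auto simp: nth_list_update split: if_splits)
  show "p \<in> stars (B[p := None])" using st by simp
qed

text \<open>Erasing \<open>v\<close> inverts writing \<open>v\<close> onto a star, and a state of
  size \<open>h\<close> has \<open>k - h\<close> stars to choose from.\<close>

lemma card_layer_containing:
  assumes v: "v < n"
  shows "card {B \<in> layer n k (Suc h). v \<in> elems B} = card {A \<in> layer n k h. v \<notin> elems A} * (k - h)"
proof -
  let ?S = "SIGMA A:{A \<in> layer n k h. v \<notin> elems A}. stars A"
  have "bij_betw (\<lambda>(A, p). A[p := Some v]) ?S {B \<in> layer n k (Suc h). v \<in> elems B}"
    unfolding bij_betw_def
  proof
    show "inj_on (\<lambda>(A, p). A[p := Some v]) ?S"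
    proof (rule inj_onI, clarify)
      fix A p A' p' assume *: "A \<in> layer n k h" "v \<notin> elems A" "p \<in> stars A"
        "A' \<in> layer n k h" "v \<notin> elems A'" "p' \<in> stars A'" "A[p := Some v] = A'[p' := Some v]"
      have l: "length A = k" "length A' = k" using *(1,4) by (auto dest: length_layer)
      have p: "p < k" "A ! p = None" "p' < k" "A' ! p' = None" using * l by (auto simp: stars_def)
      have "A'[p' := Some v] ! p = Some v" using *(7)[symmetric] p l by simp
      then have pp: "p = p'" using *(5) p l by (auto simp: nth_list_update elems_iff split: if_splits)
      have "A = A[p := Some v, p := None]" using p l by (metis list_update_id list_update_overwrite)
      also have "\<dots> = A'[p' := Some v, p' := None]" using *(7) pp by simp
      also have "\<dots> = A'" using p l by (metis list_update_id list_update_overwrite)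
      finally show "A = A' \<and> p = p'" using pp by simp
    qed
    show "(\<lambda>(A, p). A[p := Some v]) ` ?S = {B \<in> layer n k (Suc h). v \<in> elems B}"
    proof
      show "(\<lambda>(A, p). A[p := Some v]) ` ?S \<subseteq> {B \<in> layer n k (Suc h). v \<in> elems B}"
        using v by (auto simp: layer_update elems_update)
      show "{B \<in> layer n k (Suc h). v \<in> elems B} \<subseteq> (\<lambda>(A, p). A[p := Some v]) ` ?S"
      proof clarify
        fix B assume B: "B \<in> layer n k (Suc h)" "v \<in> elems B"
        then obtain p where p: "p < k" "B ! p = Some v" by (auto simp: elems_iff length_layer)
        have "B = (B[p := None])[p := Some v]" using p by (metis list_update_id list_update_overwrite)
        then show "B \<in> (\<lambda>(A, p). A[p := Some v]) ` ?S"
          using layer_erase[OF B(1) p] by (intro image_eqI[of _ _ "(B[p := None], p)"]) auto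
      qed
    qed
  qed
  from bij_betw_same_card[OF this, symmetric]
  have "card {B \<in> layer n k (Suc h). v \<in> elems B} = card ?S" .
  also have "\<dots> = (\<Sum>A\<in>{A \<in> layer n k h. v \<notin> elems A}. card (stars A))"
    using finite_layer by (intro card_SigmaI) auto
  also have "\<dots> = (\<Sum>A\<in>{A \<in> layer n k h. v \<notin> elems A}. k - h)"
    by (intro sum.cong) (auto simp: card_stars)
  finally show ?thesis by simp
qed

lemma sum_card_containing:
  "(\<Sum>v<n. card {A \<in> layer n k h. v \<in> elems A}) = h * card (layer n k h)"
proof -
  have "(\<Sum>v<n. card {A \<in> layer n k h. v \<in> elems A}) = (\<Sum>A\<in>layer n k h. card {v \<in> {..<n}. v \<in> elems A})"
    using finite_layer by (intro sum_multicount_gen) auto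
  also have "\<dots> = (\<Sum>A\<in>layer n k h. h)"
  proof (intro sum.cong refl)
    fix A assume A: "A \<in> layer n k h"
    then have "{v \<in> {..<n}. v \<in> elems A} = elems A" using elems_layer by blast
    then show "card {v \<in> {..<n}. v \<in> elems A} = h" using card_elems[OF A] by simp
  qed
  finally show ?thesis by simp
qed

text \<open>Counts pairs of a state of size \<open>Suc h\<close> and one of its elements. The
  right-hand side is also the number of moves out of layer \<open>h\<close>, so the growth of the
  layers and the number of walk edges both follow without a closed formula for layer sizes.\<close>

lemma card_layer_Suc:
  "Suc h * card (layer n k (Suc h)) = card (layer n k h) * (n - h) * (k - h)"
proof -
  have "Suc h * card (layer n k (Suc h)) = (\<Sum>v<n. card {A \<in> layer n k h. v \<notin> elems A}) * (k - h)"
    unfolding sum_card_containing[symmetric] sum_distrib_right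
    by (intro sum.cong) (auto simp: card_layer_containing)
  also have "(\<Sum>v<n. card {A \<in> layer n k h. v \<notin> elems A}) =
      (\<Sum>A\<in>layer n k h. card {v \<in> {..<n}. v \<notin> elems A})"
    using finite_layer by (intro sum_multicount_gen) auto
  also have "\<dots> = (\<Sum>A\<in>layer n k h. n - h)"
  proof (intro sum.cong refl)
    fix A assume A: "A \<in> layer n k h"
    have "{v \<in> {..<n}. v \<notin> elems A} = {..<n} - elems A" by auto
    then show "card {v \<in> {..<n}. v \<notin> elems A} = n - h"
      using card_elems[OF A] elems_layer[OF A] by (simp add: card_Diff_subset)
  qed
  finally show ?thesis by simp
qed

lemma layer_nonempty:
  assumes "h \<le> k" "k \<le> n" shows "0 < card (layer n k h)"
  using assms(1)
proof (induction h)
  case 0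
  have "replicate k None \<in> layer n k 0"
    by (auto simp: layer_def partial_subsets_iff filled_def)
  then show ?case using finite_layer card_gt_0_iff by blast
next
  case (Suc h)
  then have "0 < Suc h * card (layer n k (Suc h))"
    unfolding card_layer_Suc using assms by simp
  then show ?case by (simp only: nat_0_less_mult_iff)
qed

text \<open>By symmetry the true proportion is \<open>h / n\<close>. The weaker
  \<open>h / (n - h)\<close> comes directly from the recursion, by forgetting that the smaller state
  avoids \<open>v\<close>, and is good enough because \<open>h\<close> is small against
  \<open>n\<close>.\<close>

lemma card_containing_le:
  assumes "v < n" "h \<le> k"
  shows "card {B \<in> layer n k h. v \<in> elems B} * (n - h) \<le> h * card (layer n k h)"
proof (cases h)
  case 0
  then have "elems B = {}" if "B \<in> layer n k h" for B
    using card_elems[OF that] by simp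
  then have "{B \<in> layer n k h. v \<in> elems B} = {}" by blast
  then show ?thesis by (simp only: card.empty)
next
  case (Suc g)
  have "card {B \<in> layer n k h. v \<in> elems B} * (n - h) \<le> card {A \<in> layer n k g. v \<notin> elems A} * (k - g) * (n - g)"
    unfolding Suc card_layer_containing[OF assms(1)] by (intro mult_left_mono) auto
  also have "\<dots> \<le> card (layer n k g) * (k - g) * (n - g)"
    using finite_layer by (intro mult_right_mono card_mono) auto
  also have "\<dots> = h * card (layer n k h)"
    unfolding Suc card_layer_Suc by (simp add: ac_simps)
  finally show ?thesis .
qed

text \<open>A union bound over \<open>J\<close>: a fixed element lies in a state of size
  \<open>h = k - l\<close> with probability at most \<open>h / (n - h)\<close>, and
  \<open>4 * l * k \<le> n\<close> makes \<open>l\<close> times this at most 1/2.\<close>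

lemma card_avoiding:
  assumes J: "J \<subseteq> {..<n}" "card J = l" and l: "0 < l" "l \<le> k" and n: "4 * l * k \<le> n"
  shows "card (layer n k (k - l)) \<le> 2 * card (avoiding n k l J)"
proof -
  let ?h = "k - l" let ?L = "layer n k ?h" and ?bad = "\<lambda>v. {B \<in> layer n k (k - l). v \<in> elems B}"
  have "1 \<le> 4 * l" using l by simp
  from mult_le_mono1[OF this, of k] n have kn: "k \<le> n" by linarith
  have "?L \<subseteq> avoiding n k l J \<union> (\<Union>v\<in>J. ?bad v)"
    by (auto simp: avoiding_def)
  then have "card ?L \<le> card (avoiding n k l J \<union> (\<Union>v\<in>J. ?bad v))"
    using finite_layer J finite_subset[OF J(1)] by (intro card_mono) (auto simp: avoiding_def)
  also have "\<dots> \<le> card (avoiding n k l J) + card (\<Union>v\<in>J. ?bad v)"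
    by (rule card_Un_le)
  also have "card (\<Union>v\<in>J. ?bad v) \<le> (\<Sum>v\<in>J. card (?bad v))"
    using finite_subset[OF J(1)] by (intro card_UN_le) auto
  finally have 1: "card ?L \<le> card (avoiding n k l J) + (\<Sum>v\<in>J. card (?bad v))" by simp
  have "(\<Sum>v\<in>J. card (?bad v)) * (n - ?h) \<le> (\<Sum>v\<in>J. ?h * card ?L)"
    unfolding sum_distrib_right using J by (intro sum_mono card_containing_le) auto
  also have "\<dots> = l * ?h * card ?L" using J by simp
  finally have 2: "(\<Sum>v\<in>J. card (?bad v)) * (n - ?h) \<le> l * ?h * card ?L" .
  have "2 * (l * ?h) + ?h \<le> 2 * (l * k) + l * k"
    using l by (intro add_mono mult_le_mono) (auto intro: order_trans[of _ k])
  moreover have "4 * (l * k) \<le> n" using n by (simp add: mult.assoc)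
  ultimately have 3: "2 * (l * ?h) \<le> n - ?h" by linarith
  have pos: "0 < n - ?h" using l kn by simp
  have "(2 * (\<Sum>v\<in>J. card (?bad v))) * (n - ?h) \<le> 2 * (l * ?h) * card ?L"
    using 2 by simp
  also have "\<dots> \<le> card ?L * (n - ?h)" using 3 by (simp add: mult.commute)
  finally have "2 * (\<Sum>v\<in>J. card (?bad v)) \<le> card ?L" using pos by simp
  with 1 show ?thesis by linarith
qed

text \<open>One more element multiplies the size by \<open>(n - h) * (k - h) / Suc h\<close>. Here
  \<open>k - h \<le> l\<close> and \<open>Suc h \<ge> k / l\<close>, so the factor is at most
  \<open>l\<^sup>2 * n / k\<close>; the square of \<open>l\<close> is the price of a uniform
  bound.\<close>

lemma card_layer_ratio:
  assumes l: "0 < l" "l \<le> k" and n: "k \<le> n" and t: "t \<le> l"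
  shows "real (card (layer n k (k - l + t))) \<le>
    real (card (layer n k (k - l))) * (real (l\<^sup>2) * (real n / real k)) ^ t"
  using t
proof (induction t)
  case (Suc t)
  let ?q = "real (l\<^sup>2) * (real n / real k)" and ?h = "k - l + t"
  have k: "0 < k" using l by simp
  \<comment> \<open>With \<open>k = l + d\<close> the claim reduces to \<open>d \<le> d * l\<close>;
    it covers \<open>k = l\<close> too, where the walk starts from the empty state.\<close>
  have h1: "real k \<le> real (Suc ?h) * real l"
  proof -
    obtain d where d: "k = l + d" using l(2) le_Suc_ex by blast
    have "d \<le> d * l" using l(1) by simp
    then have "k \<le> d * l + l + t * l" using d by linarith
    then have "k \<le> Suc ?h * l" using d by (simp add: algebra_simps)
    then show ?thesis by (metis of_nat_le_iff of_nat_mult)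
  qed
  have "real (Suc ?h) * real (card (layer n k (Suc ?h))) =
      real (card (layer n k ?h)) * real (n - ?h) * real (k - ?h)"
    using card_layer_Suc[of ?h n k] by (metis of_nat_mult)
  also have "\<dots> \<le> real (card (layer n k ?h)) * real n * real l"
    by (intro mult_mono) auto
  finally have "real (Suc ?h) * real (card (layer n k (Suc ?h))) * real l \<le>
      real (card (layer n k ?h)) * real n * real l * real l"
    by (rule mult_right_mono) simp
  moreover have "real k * real (card (layer n k (Suc ?h))) \<le> real (Suc ?h) * real l * real (card (layer n k (Suc ?h)))"
    using h1 by (rule mult_right_mono) simp
  ultimately have "real k * real (card (layer n k (Suc ?h))) \<le> real (card (layer n k ?h)) * real n * real l * real l"
    by (simp add: mult_ac)
  then have "real (card (layer n k (Suc ?h))) \<le> real (card (layer n k ?h)) * ?q"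
    using k by (simp add: field_simps power2_eq_square)
  also have "\<dots> \<le> (real (card (layer n k (k - l))) * ?q ^ t) * ?q"
    using Suc by (intro mult_right_mono) auto
  finally show ?case by (simp add: mult_ac)
qed simp

lemma ratio_ge_1:
  assumes "0 < l" "l \<le> k" "k \<le> n"
  shows "1 \<le> real (l\<^sup>2) * (real n / real k)"
proof -
  have "1 \<le> real (l\<^sup>2)" using assms by (simp add: Suc_leI)
  moreover have "1 \<le> real n / real k" using assms by simp
  ultimately show ?thesis using mult_mono[of 1 "real (l\<^sup>2)" 1 "real n / real k"] by simp
qed

text \<open>The moves out of layer \<open>h\<close> number \<open>Suc h\<close> times the size of
  the next layer, and \<open>Suc h \<le> k\<close>. This is the origin of the factor
  \<open>k\<close> in front of the update costs. The exponent is raised to \<open>l\<close> since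
  the ratio is at least 1.\<close>

lemma card_layer_edges_le:
  assumes l: "0 < l" "l \<le> k" and n: "k \<le> n" and t: "t < l"
  shows "real (card (layer n k (k - l + t)) * (n - (k - l + t)) * (k - (k - l + t))) \<le>
    real (card (layer n k (k - l))) * (real (l\<^sup>2) * (real n / real k)) ^ l * real k"
proof -
  let ?q = "real (l\<^sup>2) * (real n / real k)" and ?h = "k - l + t"
  note q = ratio_ge_1[OF l n]
  have "real (card (layer n k ?h) * (n - ?h) * (k - ?h)) = real (card (layer n k (Suc ?h))) * real (Suc ?h)"
    unfolding card_layer_Suc[symmetric] of_nat_mult by (rule mult.commute)
  also have "\<dots> \<le> (real (card (layer n k (k - l))) * ?q ^ Suc t) * real k"
    using card_layer_ratio[OF l n, of "Suc t"] t l by (intro mult_mono) auto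
  also have "\<dots> \<le> (real (card (layer n k (k - l))) * ?q ^ l) * real k"
    using q t by (intro mult_right_mono mult_left_mono power_increasing) auto
  finally show ?thesis by simp
qed

lemma layer_full_subsets: "layer n k k \<subseteq> full_subsets {..<n} k"
proof
  fix A assume A: "A \<in> layer n k k"
  then have len: "length A = k" by (rule length_layer)
  have "stars A = {}" using card_stars[OF A] by simp
  then have nn: "A ! i \<noteq> None" if "i < k" for i using that len by (auto simp: stars_def)
  have "distinct A"
    unfolding distinct_conv_nth using A nn by (auto simp: layer_def partial_subsets_iff) (metis not_None_eq)
  moreover have "set A \<subseteq> Some ` {..<n}"
  proof
    fix a assume "a \<in> set A"
    then obtain i where i: "i < k" "A ! i = a" using len by (auto simp: in_set_conv_nth)
    then obtain x where "a = Some x" using nn by blast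
    then show "a \<in> Some ` {..<n}" using A i by (auto simp: layer_def partial_subsets_iff)
  qed
  ultimately show "A \<in> full_subsets {..<n} k" using len by (simp add: full_subsets_def)
qed

section \<open>Tuples of states\<close>

lemma tuples_0 [simp]: "tuples 0 X = {[]}"
  by (auto simp: tuples_def)

lemma tuples_Suc: "tuples (Suc r) X = (\<lambda>(As, a). As @ [a]) ` (tuples r X \<times> X r)"
proof
  show "tuples (Suc r) X \<subseteq> (\<lambda>(As, a). As @ [a]) ` (tuples r X \<times> X r)"
  proof
    fix Bs assume B: "Bs \<in> tuples (Suc r) X"
    then have l: "length Bs = Suc r" by (simp add: tuples_def)
    have "Bs ! i \<in> X i" if "i < Suc r" for i using B that by (simp add: tuples_def)
    then have "take r Bs \<in> tuples r X" "Bs ! r \<in> X r" using l by (auto simp: tuples_def)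
    moreover have "Bs = take r Bs @ [Bs ! r]" using l by (metis take_Suc_conv_app_nth lessI order_refl take_all)
    ultimately show "Bs \<in> (\<lambda>(As, a). As @ [a]) ` (tuples r X \<times> X r)" by (intro image_eqI[of _ _ "(take r Bs, Bs ! r)"]) auto
  qed
  show "(\<lambda>(As, a). As @ [a]) ` (tuples r X \<times> X r) \<subseteq> tuples (Suc r) X"
    by (auto simp: tuples_def nth_append less_Suc_eq)
qed

lemma finite_tuples: "(\<And>i. i < r \<Longrightarrow> finite (X i)) \<Longrightarrow> finite (tuples r X)"
  by (induction r) (auto simp: tuples_Suc)

lemma card_tuples: "card (tuples r X) = (\<Prod>i<r. card (X i))"
proof (induction r)
  case (Suc r)
  have "inj_on (\<lambda>(As, a). As @ [a]) (tuples r X \<times> X r)" by (auto simp: inj_on_def)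
  then show ?case using Suc by (simp add: tuples_Suc card_image card_cartesian_product)
qed simp

lemma tuples_cong: "(\<And>i. i < r \<Longrightarrow> X i = Y i) \<Longrightarrow> tuples r X = tuples r Y"
  by (auto simp: tuples_def)

lemma tuples_update:
  assumes "As \<in> tuples r X" "B \<in> Y i" "\<And>j. j < r \<Longrightarrow> j \<noteq> i \<Longrightarrow> X j = Y j"
  shows "As[i := B] \<in> tuples r Y"
  unfolding tuples_def mem_Collect_eq
proof (intro conjI allI impI)
  show "length (As[i := B]) = r" using assms(1) by (simp add: tuples_def)
  fix j assume "j < r"
  then show "As[i := B] ! j \<in> Y j"
    using assms by (cases "j = i") (auto simp: tuples_def)
qed

lemma uniform_expectation_eq:
  assumes "finite X" "X \<noteq> {}"
  shows "uniform_expectation X g = (\<Sum>x\<in>X. g x) / real (card X)"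
  unfolding uniform_expectation_def by (rule integral_pmf_of_set[OF assms(2,1)])

text \<open>For empty \<open>X\<close> both sides are zero, whatever \<open>pmf_of_set {}\<close>
  is, so sums turn into expectations without a check for nonemptiness.\<close>

lemma sum_eq_card_uniform_expectation:
  assumes "finite X" shows "(\<Sum>x\<in>X. g x) = real (card X) * uniform_expectation X g"
  using uniform_expectation_eq[of X g] assms by (cases "X = {}") auto

text \<open>At most half of \<open>Y\<close> is lost; this is the second factor 2 of each
  level.\<close>

lemma card_alpha_subset:
  assumes "alpha_subset a X Y" "finite Y" "a \<le> 1 / 2"
  shows "real (card Y) \<le> 2 * real (card X)"
proof (cases "Y = {}")
  case False
  have XY: "X \<subseteq> Y" using assms by (simp add: alpha_subset_def)
  have "measure_pmf.prob (pmf_of_set Y) (- X) = real (card (Y \<inter> - X)) / real (card Y)"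
    using False assms by (simp add: measure_pmf_of_set)
  then have "real (card (Y \<inter> - X)) / real (card Y) \<le> 1 / 2"
    using assms unfolding alpha_subset_def by linarith
  moreover have "0 < real (card Y)" using False assms by (simp add: card_gt_0_iff)
  ultimately have "2 * real (card (Y \<inter> - X)) \<le> real (card Y)" by (simp add: field_simps)
  moreover have "card (Y \<inter> - X) = card Y - card X" "card X \<le> card Y"
    using XY assms finite_subset[OF XY] by (auto simp: card_Diff_subset Diff_eq[symmetric] card_mono)
  ultimately show ?thesis by linarith
qed simp

section \<open>Filling stars\<close>

text \<open>Taking the smallest star makes the path of the walk deterministic. Any rule would do,
  since admissibility covers every way of filling.\<close>

definition fill :: "state \<Rightarrow> nat list \<Rightarrow> state" where
  "fill A xs = foldl (\<lambda>B v. B[Min (stars B) := Some v]) A xs"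

lemma fill_Nil [simp]: "fill A [] = A"
  by (simp add: fill_def)

lemma fill_snoc: "fill A (xs @ [v]) = (fill A xs)[Min (stars (fill A xs)) := Some v]"
  by (simp add: fill_def)

lemma Min_stars: "A \<in> layer n k h \<Longrightarrow> h < k \<Longrightarrow> Min (stars A) \<in> stars A"
  using card_stars[of A n k h] by (intro Min_in) auto

lemma state_le_refl: "state_le A A"
  by (simp add: state_le_def)

lemma state_le_trans: "state_le A B \<Longrightarrow> state_le B C \<Longrightarrow> state_le A C"
  by (simp add: state_le_def)

lemma state_le_update: "p \<in> stars A \<Longrightarrow> state_le A (A[p := Some v])"
  by (auto simp: state_le_def stars_def nth_list_update)

lemma fill_layer:
  assumes "A \<in> layer n k h" "distinct xs" "set xs \<inter> elems A = {}" "set xs \<subseteq> {..<n}" "h + length xs \<le> k"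
  shows "fill A xs \<in> layer n k (h + length xs) \<and> elems (fill A xs) = elems A \<union> set xs \<and>
    state_le A (fill A xs)"
  using assms(2-)
proof (induction xs rule: rev_induct)
  case Nil
  then show ?case using assms(1) by (simp add: state_le_refl)
next
  case (snoc v xs)
  then have IH: "fill A xs \<in> layer n k (h + length xs)" "elems (fill A xs) = elems A \<union> set xs"
    "state_le A (fill A xs)" by auto
  have p: "Min (stars (fill A xs)) \<in> stars (fill A xs)"
    using Min_stars[OF IH(1)] snoc.prems by simp
  have v: "v < n" "v \<notin> elems (fill A xs)" using snoc.prems IH(2) by auto
  have "fill A (xs @ [v]) \<in> layer n k (h + length (xs @ [v]))"
    using layer_update[OF IH(1) v p] by (simp add: fill_snoc)
  moreover have "elems (fill A (xs @ [v])) = elems A \<union> set (xs @ [v])"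
    using elems_update[OF p, of v] IH(2) by (auto simp: fill_snoc)
  moreover have "state_le A (fill A (xs @ [v]))"
    unfolding fill_snoc using state_le_trans[OF IH(3) state_le_update[OF p]] .
  ultimately show ?case by blast
qed

text \<open>\<open>A\<close> arises from \<open>B\<close> by erasing the entries in
  \<open>J\<close>. Only some of \<open>J\<close> may be present in \<open>B\<close>, so this
  inverts the walk at intermediate times as well.\<close>

lemma state_recovery:
  assumes "A \<in> partial_subsets X k" "B \<in> partial_subsets X k" "state_le A B"
    "elems B \<subseteq> elems A \<union> J" "elems A \<inter> J = {}" "i < k"
  shows "A ! i = (if B ! i \<in> Some ` J then None else B ! i)"
proof (cases "A ! i")
  case None
  \<comment> \<open>Otherwise \<open>x\<close> sits in \<open>A\<close> at another position, which
    \<open>B\<close> inherits, and \<open>B\<close> would contain \<open>x\<close> twice.\<close>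
  have "x \<in> J" if x: "B ! i = Some x" for x
  proof (rule ccontr)
    assume "x \<notin> J"
    moreover have "x \<in> elems B" using x assms by (auto simp: elems_iff partial_subsets_iff)
    ultimately have "x \<in> elems A" using assms(4) by blast
    then obtain j where j: "j < k" "A ! j = Some x" using assms(1) by (auto simp: elems_iff partial_subsets_iff)
    then have "B ! j = Some x" using assms(1,3) by (simp add: state_le_def partial_subsets_iff)
    then have "j = i" using x j assms(2,6) unfolding partial_subsets_iff by blast
    with j None show False by simp
  qed
  then show ?thesis using None by (cases "B ! i") auto
next
  case (Some x)
  then have "x \<in> elems A" "B ! i = Some x"
    using assms(1,3,6) by (auto simp: elems_iff state_le_def partial_subsets_iff)
  then show ?thesis using Some assms(5) by auto
qed

lemma state_recovery_eq:
  assumes "A \<in> partial_subsets X k" "A' \<in> partial_subsets X k" "B \<in> partial_subsets X k"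
    "state_le A B" "state_le A' B" "elems B \<subseteq> elems A \<union> J" "elems B \<subseteq> elems A' \<union> J"
    "elems A \<inter> J = {}" "elems A' \<inter> J = {}"
  shows "A = A'"
proof (rule nth_equalityI)
  show "length A = length A'" using assms(1,2) by (simp add: partial_subsets_iff)
  show "A ! i = A' ! i" if "i < length A" for i
  proof -
    have "i < k" using that assms(1) by (simp add: partial_subsets_iff)
    then show ?thesis
      using state_recovery[OF assms(1,3,4,6,8)] state_recovery[OF assms(2,3,5,7,9)] by simp
  qed
qed

section \<open>The schedule of the walk\<close>

text \<open>The time at which level \<open>i\<close> begins; \<open>offset l r\<close> is the total
  number of elements added.\<close>

definition offset :: "(nat \<Rightarrow> nat) \<Rightarrow> nat \<Rightarrow> nat" where
  "offset l i = (\<Sum>j<i. l j)"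

text \<open>One element is added per step, and the levels are completed one after another.\<close>

definition progress :: "(nat \<Rightarrow> nat) \<Rightarrow> nat \<Rightarrow> nat \<Rightarrow> nat" where
  "progress l t j = min (l j) (t - offset l j)"

lemma offset_Suc: "offset l (Suc i) = offset l i + l i"
  by (simp add: offset_def)

lemma offset_mono: "i \<le> j \<Longrightarrow> offset l i \<le> offset l j"
  unfolding offset_def by (intro sum_mono2) auto

lemma level_exists: "t < offset l r \<Longrightarrow> \<exists>i<r. offset l i \<le> t \<and> t < offset l (Suc i)"
proof (induction r)
  case (Suc r)
  show ?case
  proof (cases "t < offset l r")
    case True
    then show ?thesis using Suc.IH less_SucI by blast
  next
    case False
    then show ?thesis using Suc.prems by (intro exI[of _ r]) auto
  qed
qed (simp add: offset_def)

definition level :: "(nat \<Rightarrow> nat) \<Rightarrow> nat \<Rightarrow> nat \<Rightarrow> nat" where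
  "level l r t = (SOME i. i < r \<and> offset l i \<le> t \<and> t < offset l (Suc i))"

lemma level_props:
  assumes "t < offset l r"
  shows "level l r t < r" "offset l (level l r t) \<le> t" "t < offset l (Suc (level l r t))"
  using someI_ex[OF level_exists[OF assms]] unfolding level_def by auto

lemma progress_0 [simp]: "progress l 0 j = 0"
  by (simp add: progress_def)

lemma progress_le: "progress l t j \<le> l j"
  by (simp add: progress_def)

lemma progress_end: "j < r \<Longrightarrow> progress l (offset l r) j = l j"
  using offset_mono[of "Suc j" r l] by (simp add: progress_def offset_Suc)

text \<open>Exactly one level is active at a time, with earlier levels complete and later ones
  untouched. These are the three kinds of levels over which \<open>update_cost\<close>
  averages.\<close>

lemma progress_level:
  assumes "t < offset l r"
  defines "i \<equiv> level l r t"
  shows "j < i \<Longrightarrow> progress l t j = l j" "i < j \<Longrightarrow> progress l t j = 0"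
    "progress l t i < l i" "progress l (Suc t) i = Suc (progress l t i)"
    "j \<noteq> i \<Longrightarrow> progress l (Suc t) j = progress l t j"
proof -
  note i = level_props[OF assms(1), folded i_def]
  have lo: "offset l (Suc j) \<le> t" if "j < i" for j
    using offset_mono[of "Suc j" i l] i that by simp
  have hi: "t < offset l j" if "i < j" for j
    using offset_mono[of "Suc i" j l] i that by simp
  show "j < i \<Longrightarrow> progress l t j = l j" "i < j \<Longrightarrow> progress l t j = 0"
    using lo[of j] hi[of j] by (auto simp: progress_def offset_Suc)
  show "progress l t i < l i" "progress l (Suc t) i = Suc (progress l t i)"
    using i by (auto simp: progress_def offset_Suc)
  show "j \<noteq> i \<Longrightarrow> progress l (Suc t) j = progress l t j"
    using lo[of j] hi[of j] by (cases j i rule: linorder_cases) (auto simp: progress_def offset_Suc)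
qed

section \<open>The walk of a configuration\<close>

text \<open>One configuration with a fixed parameter. The asymptotic hypotheses enter as two
  inequalities that hold for all large parameters, and all constants are explicit.\<close>

locale johnson_walk =
  fixes r :: nat and l :: "nat \<Rightarrow> nat" and c :: "'v configuration"
  assumes adm: "admissible r l c"
    and n_large: "i < r \<Longrightarrow> 4 * l i * cf_k c i \<le> cf_n c i"
    and alpha_le: "cf_alpha c \<le> 1 / 2"
begin

abbreviation "n \<equiv> cf_n c"
abbreviation "k \<equiv> cf_k c"

lemma valid: "valid_configuration r l c"
  using adm by (simp add: admissible_def)

lemma l_bounds: "i < r \<Longrightarrow> 0 < l i" "i < r \<Longrightarrow> l i \<le> k i"
  using valid by (auto simp: valid_configuration_def)

lemma k_le_n: "i < r \<Longrightarrow> k i \<le> n i"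
proof -
  assume i: "i < r"
  have "1 \<le> 4 * l i" using l_bounds(1)[OF i] by simp
  from mult_le_mono1[OF this, of "k i"] n_large[OF i] show ?thesis by linarith
qed

definition height :: "nat \<Rightarrow> nat \<Rightarrow> nat" where
  "height t j = k j - l j + progress l t j"

definition states :: "nat \<Rightarrow> state list set" where
  "states t = tuples r (\<lambda>j. layer (n j) (k j) (height t j))"

text \<open>A flow only fills the smallest star, but every star and every new element give an edge,
  because \<open>update_cost\<close> averages over all of them.\<close>

definition moves :: "nat \<Rightarrow> (state list \<times> state list) set" where
  "moves t = (\<lambda>(As, v, p). (As, As[level l r t := (As ! level l r t)[p := Some v]])) `
     (SIGMA As:states t. ({..<n (level l r t)} - elems (As ! level l r t)) \<times> stars (As ! level l r t))"

definition certs :: "input \<Rightarrow> state list \<Rightarrow> nat \<Rightarrow> nat list" where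
  "certs y As j = sorted_list_of_set (cf_cert c y (take j As))"

definition state_at :: "input \<Rightarrow> state list \<Rightarrow> nat \<Rightarrow> state list" where
  "state_at y As t = map (\<lambda>j. fill (As ! j) (take (progress l t j) (certs y As j))) [0..<r]"

definition reach :: "nat \<Rightarrow> input \<Rightarrow> state list set" where
  "reach m y = {As. length As = m \<and> reachable c y As}"

definition probability :: "input \<Rightarrow> state list \<Rightarrow> real" where
  "probability y As = (\<Prod>j<length As. 1 / real (card (cf_avail c y (take j As))))"

section \<open>Counting the states and moves of the walk\<close>

lemma finite_states: "finite (states t)"
  unfolding states_def by (intro finite_tuples finite_layer)

lemma states_partial: "As \<in> states t \<Longrightarrow> As \<in> partial_tuples r c"
  by (auto simp: states_def partial_tuples_def tuples_def layer_partial)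

lemma nth_states: "As \<in> states t \<Longrightarrow> j < r \<Longrightarrow> As ! j \<in> layer (n j) (k j) (height t j)"
  by (simp add: states_def tuples_def)

lemma height_end: "j < r \<Longrightarrow> height (offset l r) j = k j"
  using l_bounds(2)[of j] by (simp add: height_def progress_end)

lemma states_end: "states (offset l r) = tuples r (\<lambda>j. layer (n j) (k j) (k j))"
  unfolding states_def by (intro tuples_cong) (simp add: height_end)

lemma states_end_full: "states (offset l r) \<subseteq> full_tuples r c"
  unfolding states_end full_tuples_def tuples_def using layer_full_subsets by blast

lemma states_start: "states 0 = tuples r (\<lambda>j. layer (n j) (k j) (k j - l j))"
  unfolding states_def by (simp add: height_def)

text \<open>The position and the element can be read off the new state, so a sum over edges is a sum
  over triples.\<close>

lemma moves_inj:
  assumes "t < offset l r"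
  shows "inj_on (\<lambda>(As, v, p). (As, As[level l r t := (As ! level l r t)[p := Some v]]))
    (SIGMA As:states t. ({..<n (level l r t)} - elems (As ! level l r t)) \<times> stars (As ! level l r t))"
proof (rule inj_onI)
  let ?i = "level l r t"
  let ?f = "\<lambda>(As, v, p). (As, As[?i := (As ! ?i)[p := Some v]])"
  let ?S = "SIGMA As:states t. ({..<n ?i} - elems (As ! ?i)) \<times> stars (As ! ?i)"
  fix x x' assume x: "x \<in> ?S" "x' \<in> ?S" "?f x = ?f x'"
  obtain As v p where xe: "x = (As, v, p)" by (cases x)
  obtain As' v' p' where xe': "x' = (As', v', p')" by (cases x')
  have *: "As' = As" "As \<in> states t" "p \<in> stars (As ! ?i)"
    "As[?i := (As ! ?i)[p := Some v]] = As[?i := (As ! ?i)[p' := Some v']]"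
    using x by (auto simp: xe xe')
  have "length As = r" using *(2) by (simp add: states_def tuples_def)
  then have e: "(As ! ?i)[p := Some v] = (As ! ?i)[p' := Some v']"
    using arg_cong[OF *(4), of "\<lambda>Bs. Bs ! ?i"] level_props(1)[OF assms] by simp
  have p: "p < length (As ! ?i)" "As ! ?i ! p = None" using *(3) by (auto simp: stars_def)
  have "(As ! ?i)[p' := Some v'] ! p = Some v" using p by (simp add: e[symmetric])
  then have "v = v' \<and> p = p'" using p by (cases "p = p'") auto
  then show "x = x'" using *(1) by (simp add: xe xe')
qed

text \<open>All states of a layer have equally many free elements and equally many stars, so the
  triples are uniform and the sum is their number times the expected squared length.\<close>

lemma sum_moves:
  assumes t: "t < offset l r"
  defines "i \<equiv> level l r t"
  shows "(\<Sum>(As, Bs)\<in>moves t. (real (card (cf_data c Bs - cf_data c As)))\<^sup>2) =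
    real (card (states t) * (n i - height t i) * (k i - height t i)) * update_cost r l c i (height t i)"
proof -
  let ?h = "height t i"
  let ?g = "\<lambda>As v p. (real (card (cf_data c (As[i := (As ! i)[p := Some v]]) - cf_data c As)))\<^sup>2"
  have i: "i < r" using level_props(1)[OF t] by (simp add: i_def)
  have "(\<Sum>(As, Bs)\<in>moves t. (real (card (cf_data c Bs - cf_data c As)))\<^sup>2) =
      (\<Sum>(As, v, p)\<in>(SIGMA As:states t. ({..<n i} - elems (As ! i)) \<times> stars (As ! i)). ?g As v p)"
    unfolding moves_def i_def sum.reindex[OF moves_inj[OF t]]
    by (intro sum.cong) auto
  also have "\<dots> = (\<Sum>As\<in>states t. \<Sum>(v, p)\<in>({..<n i} - elems (As ! i)) \<times> stars (As ! i). ?g As v p)"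
    using finite_states by (subst sum.Sigma) auto
  also have "\<dots> = (\<Sum>As\<in>states t. \<Sum>v\<in>{..<n i} - elems (As ! i). \<Sum>p\<in>stars (As ! i). ?g As v p)"
    by (simp add: sum.cartesian_product)
  also have "\<dots> = (\<Sum>As\<in>states t. real (n i - ?h) * (real (k i - ?h) *
      uniform_expectation ({..<n i} - elems (As ! i)) (\<lambda>v. uniform_expectation (stars (As ! i)) (?g As v))))"
  proof (intro sum.cong refl)
    fix As assume "As \<in> states t"
    from nth_states[OF this i] have A: "As ! i \<in> layer (n i) (k i) ?h" .
    have c: "card (stars (As ! i)) = k i - ?h" "card ({..<n i} - elems (As ! i)) = n i - ?h"
      using card_stars[OF A] card_elems[OF A] elems_layer[OF A] by (simp_all add: card_Diff_subset)
    have "(\<Sum>v\<in>{..<n i} - elems (As ! i). \<Sum>p\<in>stars (As ! i). ?g As v p) =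
        (\<Sum>v\<in>{..<n i} - elems (As ! i). real (k i - ?h) * uniform_expectation (stars (As ! i)) (?g As v))"
      by (simp only: sum_eq_card_uniform_expectation[OF finite_stars] c)
    also have "\<dots> = real (k i - ?h) * (\<Sum>v\<in>{..<n i} - elems (As ! i). uniform_expectation (stars (As ! i)) (?g As v))"
      by (simp add: sum_distrib_left)
    also have "(\<Sum>v\<in>{..<n i} - elems (As ! i). uniform_expectation (stars (As ! i)) (?g As v)) =
        real (n i - ?h) * uniform_expectation ({..<n i} - elems (As ! i)) (\<lambda>v. uniform_expectation (stars (As ! i)) (?g As v))"
      using sum_eq_card_uniform_expectation[of "{..<n i} - elems (As ! i)"] c by simp
    finally show "(\<Sum>v\<in>{..<n i} - elems (As ! i). \<Sum>p\<in>stars (As ! i). ?g As v p) =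
        real (n i - ?h) * (real (k i - ?h) *
      uniform_expectation ({..<n i} - elems (As ! i)) (\<lambda>v. uniform_expectation (stars (As ! i)) (?g As v)))"
      by (simp only: mult.left_commute)
  qed
  also have "\<dots> = real (n i - ?h) * (real (k i - ?h) * (\<Sum>As\<in>states t.
      uniform_expectation ({..<n i} - elems (As ! i)) (\<lambda>v. uniform_expectation (stars (As ! i)) (?g As v))))"
    by (simp add: sum_distrib_left)
  also have "(\<Sum>As\<in>states t. uniform_expectation ({..<n i} - elems (As ! i))
        (\<lambda>v. uniform_expectation (stars (As ! i)) (?g As v))) = real (card (states t)) * update_cost r l c i ?h"
  proof -
    \<comment> \<open>The heights at time \<open>t\<close> are precisely the state sizes prescribed
      in \<open>update_cost\<close> for level \<open>i\<close>.\<close>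
    have st: "states t = tuples r (\<lambda>j. layer (n j) (k j) (if j < i then k j else if j = i then ?h else k j - l j))"
      unfolding states_def
    proof (rule tuples_cong)
      fix j assume j: "j < r"
      show "layer (n j) (k j) (height t j) = layer (n j) (k j) (if j < i then k j else if j = i then ?h else k j - l j)"
        using progress_level(1,2)[OF t, of j, folded i_def] l_bounds(2)[OF j]
        by (cases j i rule: linorder_cases) (auto simp: height_def)
    qed
    show ?thesis
      unfolding update_cost_def st[symmetric]
      by (rule sum_eq_card_uniform_expectation[OF finite_states])
  qed
  finally show ?thesis by (simp add: mult_ac)
qed

text \<open>Compared level by level with the starting tuples: completed levels contribute their
  ratio to the power \<open>l\<close>, the active one the same times \<open>k i\<close>, later ones
  1. Hence the product ends at \<open>i\<close>.\<close>

lemma card_states_moves_le: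
  assumes t: "t < offset l r"
  defines "i \<equiv> level l r t"
  shows "real (card (states t) * (n i - height t i) * (k i - height t i)) \<le>
    real (card (states 0)) * (\<Prod>j<r. real ((l j)\<^sup>2) ^ l j) *
      ((\<Prod>j\<le>i. (real (n j) / real (k j)) ^ l j) * real (k i))"
proof -
  have i: "i < r" using level_props(1)[OF t] by (simp add: i_def)
  let ?q = "\<lambda>j. real ((l j)\<^sup>2) * (real (n j) / real (k j))"
  let ?e = "(n i - height t i) * (k i - height t i)"
  let ?a = "\<lambda>j. real (card (layer (n j) (k j) (height t j))) * (if j = i then real ?e else 1)"
  let ?b = "\<lambda>j. real (card (layer (n j) (k j) (k j - l j))) * (if j \<in> {..i} then ?q j ^ l j else 1) *
      (if j = i then real (k i) else 1)"
  have "real (card (states t) * (n i - height t i) * (k i - height t i)) = (\<Prod>j<r. ?a j)"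
    using i by (simp add: states_def card_tuples prod.distrib mult.assoc)
  also have "\<dots> \<le> (\<Prod>j<r. ?b j)"
  proof (intro prod_mono conjI)
    fix j assume "j \<in> {..<r}"
    then have j: "j < r" by simp
    note lj = l_bounds[OF j] k_le_n[OF j]
    show "0 \<le> ?a j" by simp
    show "?a j \<le> ?b j"
    proof (cases j i rule: linorder_cases)
      case less
      have "height t j = k j - l j + l j"
        using progress_level(1)[OF t, of j, folded i_def] less by (simp add: height_def)
      then show ?thesis using card_layer_ratio[OF lj order_refl] less by simp
    next
      case equal
      have "progress l t i < l i" using progress_level(3)[OF t, folded i_def] .
      from card_layer_edges_le[OF lj[unfolded equal] this] show ?thesis
        using equal by (simp add: height_def mult.assoc)
    next
      case greater
      then show ?thesis
        using progress_level(2)[OF t, of j, folded i_def] by (simp add: height_def)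
    qed
  qed
  also have "\<dots> = real (card (states 0)) * (\<Prod>j<r. if j \<in> {..i} then ?q j ^ l j else 1) * real (k i)"
    using i by (simp add: states_start card_tuples prod.distrib)
  also have "(\<Prod>j<r. if j \<in> {..i} then ?q j ^ l j else 1) = (\<Prod>j\<le>i. ?q j ^ l j)"
  proof -
    have "{..<r} \<inter> {..i} = {..i}" using i by auto
    then show ?thesis by (simp only: prod.inter_restrict[OF finite_lessThan, symmetric])
  qed
  also have "(\<Prod>j\<le>i. ?q j ^ l j) =
      (\<Prod>j\<le>i. real ((l j)\<^sup>2) ^ l j) * (\<Prod>j\<le>i. (real (n j) / real (k j)) ^ l j)"
    by (simp only: power_mult_distrib prod.distrib)
  \<comment> \<open>The constants are extended from the levels up to \<open>i\<close> to all levels,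
    which are at least 1 each, so that the bound no longer depends on \<open>t\<close> through
    them.\<close>
  also have "real (card (states 0)) * \<dots> * real (k i) \<le> real (card (states 0)) *
      ((\<Prod>j<r. real ((l j)\<^sup>2) ^ l j) * (\<Prod>j\<le>i. (real (n j) / real (k j)) ^ l j)) * real (k i)"
  proof (intro mult_right_mono mult_left_mono)
    show "(\<Prod>j\<le>i. real ((l j)\<^sup>2) ^ l j) \<le> (\<Prod>j<r. real ((l j)\<^sup>2) ^ l j)"
      using i l_bounds(1) by (intro prod_mono2) (auto simp: Suc_leI)
  qed (auto intro!: prod_nonneg)
  finally show ?thesis by (simp only: mult.assoc)
qed

lemma card_states_end_le:
  "real (card (states (offset l r))) \<le>
    real (card (states 0)) * (\<Prod>j<r. real ((l j)\<^sup>2) ^ l j) * (\<Prod>j<r. (real (n j) / real (k j)) ^ l j)"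
proof -
  let ?q = "\<lambda>j. real ((l j)\<^sup>2) * (real (n j) / real (k j))"
  have "real (card (states (offset l r))) = (\<Prod>j<r. real (card (layer (n j) (k j) (k j))))"
    by (simp add: states_end card_tuples)
  also have "\<dots> \<le> (\<Prod>j<r. real (card (layer (n j) (k j) (k j - l j))) * ?q j ^ l j)"
  proof (intro prod_mono conjI)
    fix j assume "j \<in> {..<r}"
    then have j: "j < r" by simp
    show "real (card (layer (n j) (k j) (k j))) \<le> real (card (layer (n j) (k j) (k j - l j))) * ?q j ^ l j"
      using card_layer_ratio[OF l_bounds[OF j] k_le_n[OF j] order_refl] l_bounds(2)[OF j] by simp
  qed simp
  also have "\<dots> = real (card (states 0)) * ((\<Prod>j<r. real ((l j)\<^sup>2) ^ l j) * (\<Prod>j<r. (real (n j) / real (k j)) ^ l j))"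
    by (simp only: states_start card_tuples of_nat_prod prod.distrib power_mult_distrib)
  finally show ?thesis by (simp only: mult.assoc)
qed

lemma card_states_0: "0 < card (states 0)"
  unfolding states_start card_tuples
  using layer_nonempty k_le_n by (intro prod_pos) auto

section \<open>Sequential choice of the starting tuple\<close>

lemma reachable_take: "reachable c y As \<Longrightarrow> reachable c y (take j As)"
  by (auto simp: reachable_def min_def)

lemma reach_0: "reach 0 y = {[]}"
  by (auto simp: reach_def reachable_def)

lemma reach_Suc: "reach (Suc m) y = (\<lambda>(As, a). As @ [a]) ` (SIGMA As:reach m y. cf_avail c y As)"
proof
  show "reach (Suc m) y \<subseteq> (\<lambda>(As, a). As @ [a]) ` (SIGMA As:reach m y. cf_avail c y As)"
  proof
    fix Bs assume B: "Bs \<in> reach (Suc m) y"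
    then have len: "length Bs = Suc m" by (simp add: reach_def)
    have "take m Bs \<in> reach m y" using B len by (auto simp: reach_def intro: reachable_take)
    moreover have "Bs ! m \<in> cf_avail c y (take m Bs)" using B by (auto simp: reach_def reachable_def)
    moreover have "Bs = take m Bs @ [Bs ! m]" using len by (metis take_Suc_conv_app_nth lessI order_refl take_all)
    ultimately show "Bs \<in> (\<lambda>(As, a). As @ [a]) ` (SIGMA As:reach m y. cf_avail c y As)"
      by (intro image_eqI[of _ _ "(take m Bs, Bs ! m)"]) auto
  qed
  show "(\<lambda>(As, a). As @ [a]) ` (SIGMA As:reach m y. cf_avail c y As) \<subseteq> reach (Suc m) y"
    by (auto simp: reach_def reachable_def nth_append less_Suc_eq)
qed

context
  fixes y assumes y: "y \<in> ones r c"
begin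

lemma cert_facts:
  assumes "reachable c y As" "length As < r"
  shows "cf_cert c y As \<subseteq> {..<n (length As)}" "card (cf_cert c y As) = l (length As)"
    "alpha_subset (cf_alpha c) (cf_avail c y As)
       (avoiding (n (length As)) (k (length As)) (l (length As)) (cf_cert c y As))"
proof -
  have "\<forall>i<r. \<forall>As. length As = i \<and> reachable c y As \<longrightarrow>
           cf_cert c y As \<subseteq> {..<n i} \<and> card (cf_cert c y As) = l i \<and>
           alpha_subset (cf_alpha c) (cf_avail c y As) (avoiding (n i) (k i) (l i) (cf_cert c y As))"
    using adm y unfolding admissible_def by blast
  with assms show "cf_cert c y As \<subseteq> {..<n (length As)}" "card (cf_cert c y As) = l (length As)"
    "alpha_subset (cf_alpha c) (cf_avail c y As)
       (avoiding (n (length As)) (k (length As)) (l (length As)) (cf_cert c y As))"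
    by simp_all
qed

text \<open>The factor 4 combines avoiding the certificate with being available; in particular the
  next choice is always possible.\<close>

lemma avail_facts:
  assumes "reachable c y As" "length As < r"
  defines "j \<equiv> length As"
  shows "finite (cf_avail c y As)" "0 < card (cf_avail c y As)"
    "real (card (layer (n j) (k j) (k j - l j))) \<le> 4 * real (card (cf_avail c y As))"
proof -
  note f = cert_facts[OF assms(1,2), folded j_def]
  have j: "j < r" using assms by simp
  let ?Y = "avoiding (n j) (k j) (l j) (cf_cert c y As)"
  have fin: "finite ?Y" using finite_layer by (simp add: avoiding_def)
  then show "finite (cf_avail c y As)"
    using f(3) by (auto simp: alpha_subset_def intro: finite_subset)
  have "card (layer (n j) (k j) (k j - l j)) \<le> 2 * card ?Y"
    using card_avoiding[OF f(1,2) l_bounds[OF j]] n_large[OF j] by simp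
  then show 4: "real (card (layer (n j) (k j) (k j - l j))) \<le> 4 * real (card (cf_avail c y As))"
    using card_alpha_subset[OF f(3) fin alpha_le] by linarith
  have "0 < card (layer (n j) (k j) (k j - l j))"
    using layer_nonempty[of "k j - l j" "k j" "n j"] k_le_n[OF j] by simp
  with 4 show "0 < card (cf_avail c y As)" by linarith
qed

text \<open>Each choice is uniform on a nonempty finite set, so summing out the last level leaves
  the same sum with one level less.\<close>

lemma reach_facts: "m \<le> r \<Longrightarrow> finite (reach m y) \<and> (\<Sum>As\<in>reach m y. probability y As) = 1"
proof (induction m)
  case 0
  then show ?case by (simp add: reach_0 probability_def)
next
  case (Suc m)
  then have IH: "finite (reach m y)" "(\<Sum>As\<in>reach m y. probability y As) = 1" by auto
  have av: "finite (cf_avail c y As)" "0 < card (cf_avail c y As)" if "As \<in> reach m y" for As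
    using avail_facts(1,2)[of As] that Suc.prems by (auto simp: reach_def)
  have inj: "inj_on (\<lambda>(As, a). As @ [a]) (SIGMA As:reach m y. cf_avail c y As)"
    by (auto simp: inj_on_def)
  have "(\<Sum>As\<in>reach (Suc m) y. probability y As) =
      (\<Sum>(As, a)\<in>(SIGMA As:reach m y. cf_avail c y As). probability y As * (1 / real (card (cf_avail c y As))))"
    unfolding reach_Suc sum.reindex[OF inj]
    by (intro sum.cong) (auto simp: probability_def)
  also have "\<dots> = (\<Sum>As\<in>reach m y. \<Sum>a\<in>cf_avail c y As. probability y As * (1 / real (card (cf_avail c y As))))"
    using IH(1) av(1) by (subst sum.Sigma) auto
  also have "\<dots> = (\<Sum>As\<in>reach m y. probability y As)"
    using av(2) by (intro sum.cong) auto
  finally show ?case using IH av(1) by (simp add: reach_Suc)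
qed

lemma probability_nonneg: "0 \<le> probability y As"
  by (auto simp: probability_def intro!: prod_nonneg)

text \<open>Every conditional choice is at most 4 times as concentrated as a uniform element of its
  layer, and \<open>states 0\<close> is the product of these layers.\<close>

lemma probability_le:
  assumes "As \<in> reach r y" shows "probability y As \<le> 4 ^ r / real (card (states 0))"
proof -
  have len: "length As = r" using assms by (simp add: reach_def)
  have "probability y As \<le> (\<Prod>j<r. 4 / real (card (layer (n j) (k j) (k j - l j))))"
    unfolding probability_def len
  proof (intro prod_mono conjI)
    fix j assume "j \<in> {..<r}"
    then have j: "j < r" by simp
    have re: "reachable c y (take j As)" "length (take j As) = j"
      using assms j by (auto simp: reach_def reachable_take)
    note a = avail_facts[OF re(1), unfolded re(2), OF j]
    have "0 < card (layer (n j) (k j) (k j - l j))"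
      using layer_nonempty[of "k j - l j" "k j" "n j"] k_le_n[OF j] by simp
    then show "1 / real (card (cf_avail c y (take j As))) \<le> 4 / real (card (layer (n j) (k j) (k j - l j)))"
      using a by (simp add: divide_simps)
  qed simp
  also have "\<dots> = 4 ^ r / real (card (states 0))"
    by (simp add: prod_dividef states_start card_tuples)
  finally show ?thesis .
qed

section \<open>The deterministic path of one reachable tuple\<close>

context
  fixes As assumes As: "As \<in> reach r y"
begin

lemma level_facts:
  assumes j: "j < r"
  shows "As ! j \<in> layer (n j) (k j) (k j - l j)" "elems (As ! j) \<inter> cf_cert c y (take j As) = {}"
    "distinct (certs y As j)" "set (certs y As j) = cf_cert c y (take j As)"
    "length (certs y As j) = l j" "cf_cert c y (take j As) \<subseteq> {..<n j}"
proof -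
  have re: "reachable c y (take j As)" "length (take j As) = j"
    using As j by (auto simp: reach_def reachable_take)
  note f = cert_facts[OF re(1), unfolded re(2), OF j]
  have "As ! j \<in> cf_avail c y (take j As)" using As j by (simp add: reach_def reachable_def)
  then have "As ! j \<in> avoiding (n j) (k j) (l j) (cf_cert c y (take j As))"
    using f(3) by (auto simp: alpha_subset_def)
  then show "As ! j \<in> layer (n j) (k j) (k j - l j)" "elems (As ! j) \<inter> cf_cert c y (take j As) = {}"
    by (auto simp: avoiding_def)
  have "finite (cf_cert c y (take j As))" using f(1) finite_subset by blast
  then show "distinct (certs y As j)" "set (certs y As j) = cf_cert c y (take j As)"
    "length (certs y As j) = l j" "cf_cert c y (take j As) \<subseteq> {..<n j}"
    using f by (simp_all add: certs_def)
qed

lemma length_state_at [simp]: "length (state_at y As t) = r"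
  by (simp add: state_at_def)

lemma state_at_facts:
  assumes j: "j < r"
  shows "state_at y As t ! j \<in> layer (n j) (k j) (height t j)"
    "elems (state_at y As t ! j) = elems (As ! j) \<union> set (take (progress l t j) (certs y As j))"
    "state_le (As ! j) (state_at y As t ! j)"
proof -
  note f = level_facts[OF j]
  let ?xs = "take (progress l t j) (certs y As j)"
  have len: "length ?xs = progress l t j" using f(5) progress_le[of l t j] by simp
  have sub: "set ?xs \<subseteq> cf_cert c y (take j As)" using set_take_subset f(4) by fast
  have "fill (As ! j) ?xs \<in> layer (n j) (k j) (k j - l j + length ?xs) \<and>
      elems (fill (As ! j) ?xs) = elems (As ! j) \<union> set ?xs \<and> state_le (As ! j) (fill (As ! j) ?xs)"
  proof (rule fill_layer[OF f(1)])
    show "distinct ?xs" using f(3) by (rule distinct_take)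
    show "set ?xs \<inter> elems (As ! j) = {}" "set ?xs \<subseteq> {..<n j}" using sub f(2,6) by auto
    show "k j - l j + length ?xs \<le> k j"
      unfolding len using progress_le[of l t j] l_bounds(2)[OF j] by linarith
  qed
  moreover have "state_at y As t ! j = fill (As ! j) ?xs" using j by (simp add: state_at_def)
  ultimately show "state_at y As t ! j \<in> layer (n j) (k j) (height t j)"
    "elems (state_at y As t ! j) = elems (As ! j) \<union> set ?xs"
    "state_le (As ! j) (state_at y As t ! j)"
    unfolding len height_def by auto
qed

lemma state_at_states: "state_at y As t \<in> states t"
  using state_at_facts(1) by (simp add: states_def tuples_def)

lemma state_at_moves:
  assumes t: "t < offset l r"
  shows "(state_at y As t, state_at y As (Suc t)) \<in> moves t"
proof -
  let ?i = "level l r t"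
  let ?A = "state_at y As t ! ?i" and ?m = "progress l t ?i"
  have i: "?i < r" using level_props(1)[OF t] .
  note f = level_facts[OF i]
  have m: "?m < l ?i" using progress_level(3)[OF t] .
  let ?v = "certs y As ?i ! ?m" and ?p = "Min (stars ?A)"
  \<comment> \<open>One more time unit appends one certificate element to the list of the active
    level, which by \<open>fill_snoc\<close> writes it onto one star.\<close>
  have eq: "state_at y As (Suc t) = (state_at y As t)[?i := ?A[?p := Some ?v]]"
  proof (rule nth_equalityI)
    fix j assume "j < length (state_at y As (Suc t))"
    then have j: "j < r" by simp
    show "state_at y As (Suc t) ! j = (state_at y As t)[?i := ?A[?p := Some ?v]] ! j"
    proof (cases "j = ?i")
      case True
      have "take (Suc ?m) (certs y As ?i) = take ?m (certs y As ?i) @ [?v]"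
        using m f(5) by (simp add: take_Suc_conv_app_nth)
      then have "state_at y As (Suc t) ! ?i = fill (As ! ?i) (take ?m (certs y As ?i) @ [?v])"
        using i progress_level(4)[OF t] by (simp add: state_at_def)
      then show ?thesis using True i by (simp add: fill_snoc state_at_def)
    next
      case False
      then show ?thesis using j progress_level(5)[OF t False] by (simp add: state_at_def)
    qed
  qed simp
  have v: "?v \<in> set (certs y As ?i)" using m f(5) by simp
  then have "?v < n ?i" using f(4,6) by blast
  \<comment> \<open>The element is new: certificates are disjoint from the starting state, and the
    list of certificate elements has no repetition.\<close>
  moreover have "?v \<notin> elems ?A"
  proof
    assume "?v \<in> elems ?A"
    then have "?v \<in> set (take ?m (certs y As ?i))" using v f(2,4) state_at_facts(2)[OF i, of t] by blast
    then obtain a where "a < ?m" "certs y As ?i ! a = ?v" using m f(5) by (auto simp: in_set_conv_nth)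
    then show False using f(3,5) m by (simp add: nth_eq_iff_index_eq)
  qed
  moreover have "?p \<in> stars ?A"
    using Min_stars[OF state_at_facts(1)[OF i, of t]] m l_bounds(2)[OF i] by (simp add: height_def)
  ultimately show ?thesis
    unfolding moves_def eq using state_at_states
    by (intro image_eqI[of _ _ "(state_at y As t, ?v, ?p)"]) auto
qed

text \<open>All certificate elements have been inserted by then, so the final state is one of the
  fillings for which admissibility promises acceptance.\<close>

lemma state_at_end: "cf_fun c (state_at y As (offset l r)) y"
proof -
  let ?B = "state_at y As (offset l r)"
  have "?B \<in> tuples r (\<lambda>i. fillings (n i) (k i) (As ! i) (cf_cert c y (take i As)))"
    unfolding tuples_def mem_Collect_eq
  proof (intro conjI allI impI)
    fix i assume i: "i < r"
    note f = level_facts[OF i] and s = state_at_facts[OF i, of "offset l r"]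
    have "?B ! i \<in> full_subsets {..<n i} (k i)"
      using s(1) layer_full_subsets by (auto simp: height_end[OF i])
    then show "?B ! i \<in> fillings (n i) (k i) (As ! i) (cf_cert c y (take i As))"
      using s(2,3) f(4,5) by (simp add: fillings_def progress_end[OF i])
  qed simp
  then show ?thesis
    using adm y As unfolding admissible_def reach_def by blast
qed

end

lemma state_at_inj: "inj_on (\<lambda>As. state_at y As t) (reach r y)"
proof (rule inj_onI)
  fix As As' assume A: "As \<in> reach r y" "As' \<in> reach r y" and eq: "state_at y As t = state_at y As' t"
  have len: "length As = r" "length As' = r" using A by (auto simp: reach_def)
  \<comment> \<open>Induction on prefixes: the certificates of level \<open>j\<close> are known to
    coincide only after the first \<open>j\<close> states do, and then they can be erased from the
    common state.\<close>
  have "take j As = take j As'" if "j \<le> r" for j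
    using that
  proof (induction j)
    case (Suc j)
    then have j: "j < r" and IH: "take j As = take j As'" by auto
    note f = level_facts[OF A(1) j] and f' = level_facts[OF A(2) j]
    note s = state_at_facts[OF A(1) j, of t] and s' = state_at_facts[OF A(2) j, of t]
    let ?J = "cf_cert c y (take j As)"
    have J: "cf_cert c y (take j As') = ?J" using IH by simp
    have sub: "set (take m (certs y As j)) \<subseteq> ?J" "set (take m (certs y As' j)) \<subseteq> ?J" for m
      using set_take_subset f(4) f'(4) J by fast+
    have "As ! j = As' ! j"
    proof (rule state_recovery_eq)
      show "As ! j \<in> partial_subsets {..<n j} (k j)" "As' ! j \<in> partial_subsets {..<n j} (k j)"
        "state_at y As t ! j \<in> partial_subsets {..<n j} (k j)"
        using f(1) f'(1) s(1) by (auto intro: layer_partial)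
      show "state_le (As ! j) (state_at y As t ! j)" "state_le (As' ! j) (state_at y As t ! j)"
        using s(3) s'(3) eq by simp_all
      show "elems (state_at y As t ! j) \<subseteq> elems (As ! j) \<union> ?J" using s(2) sub(1) by blast
      show "elems (state_at y As t ! j) \<subseteq> elems (As' ! j) \<union> ?J"
        unfolding eq using s'(2) sub(2) by blast
      show "elems (As ! j) \<inter> ?J = {}" "elems (As' ! j) \<inter> ?J = {}" using f(2) f'(2) J by simp_all
    qed
    then show ?case using IH j len by (simp add: take_Suc_conv_app_nth)
  qed simp
  from this[of r] show "As = As'" using len by simp
qed

end

end

text \<open>One factor \<open>offset l r + 2\<close> is the \<open>T + 1\<close> of
  \<open>kappa\<close>, as the walk has one setup step besides the additions. The other collects the
  update layers and the doubled checking cost. \<open>4 ^ r\<close> comes from \<open>M\<close>, the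
  product from the layer ratios, and the final 1 from the slack \<open>S\<^sup>2\<close>.\<close>

definition walk_constant :: "nat \<Rightarrow> (nat \<Rightarrow> nat) \<Rightarrow> real" where
  "walk_constant r l = (real (offset l r) + 2)\<^sup>2 * 4 ^ r * (\<Prod>j<r. real ((l j)\<^sup>2) ^ l j) + 1"

section \<open>The bound for one configuration\<close>

context johnson_walk
begin

lemma setup_sum:
  "(\<Sum>As\<in>states 0. (real (card (cf_data c As)))\<^sup>2) = real (card (states 0)) * setup_cost r l c"
  unfolding setup_cost_def states_start[symmetric]
  by (rule sum_eq_card_uniform_expectation[OF finite_states])

lemma checking_sum:
  "(\<Sum>As\<in>states (offset l r). C0 (cf_graph c As (restrict x (cf_data c As))) x *
      C1_max (subdomain c As (restrict x (cf_data c As))) (cf_fun c As)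
        (cf_graph c As (restrict x (cf_data c As)))) =
   real (card (states (offset l r))) * checking_cost r c x"
  unfolding checking_cost_def states_end[symmetric] Let_def
  by (rule sum_eq_card_uniform_expectation[OF finite_states])

lemma data_sub: "As \<in> states t \<Longrightarrow> cf_data c As \<subseteq> {..<cf_N c}"
  using valid states_partial unfolding valid_configuration_def by blast

lemma moves_sub:
  assumes t: "t < offset l r"
  shows "moves t \<subseteq> states t \<times> states (Suc t)"
    and "(As, Bs) \<in> moves t \<Longrightarrow> cf_data c As \<subseteq> cf_data c Bs"
proof -
  let ?i = "level l r t"
  have i: "?i < r" using level_props(1)[OF t] .
  have *: "As \<in> states t \<and> Bs \<in> states (Suc t) \<and> cf_data c As \<subseteq> cf_data c Bs"
    if m: "(As, Bs) \<in> moves t" for As Bs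
  proof -
    obtain v p where As: "As \<in> states t" and v: "v < n ?i" "v \<notin> elems (As ! ?i)"
      and p: "p \<in> stars (As ! ?i)" and Bs: "Bs = As[?i := (As ! ?i)[p := Some v]]"
      using m by (auto simp: moves_def)
    have B: "(As ! ?i)[p := Some v] \<in> layer (n ?i) (k ?i) (Suc (height t ?i))"
      by (rule layer_update[OF nth_states[OF As i] v p])
    have "Bs \<in> states (Suc t)"
      unfolding Bs states_def
    proof (rule tuples_update)
      show "As \<in> tuples r (\<lambda>j. layer (n j) (k j) (height t j))" using As by (simp add: states_def)
      show "(As ! ?i)[p := Some v] \<in> layer (n ?i) (k ?i) (height (Suc t) ?i)"
        using B progress_level(4)[OF t] by (simp add: height_def)
      show "layer (n j) (k j) (height t j) = layer (n j) (k j) (height (Suc t) j)" if "j \<noteq> ?i" for j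
        using progress_level(5)[OF t that] by (simp add: height_def)
    qed
    moreover have "cf_data c As \<subseteq> cf_data c Bs"
      unfolding Bs
      using valid states_partial[OF As] i layer_partial[OF B] state_le_update[OF p]
      unfolding valid_configuration_def by blast
    ultimately show ?thesis using As by blast
  qed
  show "moves t \<subseteq> states t \<times> states (Suc t)" by (auto dest: *)
  show "(As, Bs) \<in> moves t \<Longrightarrow> cf_data c As \<subseteq> cf_data c Bs" using * by blast
qed

lemma inner_graphs_exist:
  assumes "0 < \<delta>"
  shows "\<exists>H. \<forall>As\<in>states (offset l r). \<forall>lam\<in>cf_data c As \<rightarrow>\<^sub>E UNIV.
    adaptive_learning_graph (cf_N c) (subdomain c As lam) (cf_fun c As) (H As lam :: 'v learning_graph) \<and>
    (\<forall>y\<in>subdomain c As lam. cf_fun c As y \<longrightarrow> C1 (H As lam) y \<le> 1) \<and>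
    (\<forall>x\<in>subdomain c As lam. C0 (H As lam) x \<le>
       C0 (cf_graph c As lam) x * C1_max (subdomain c As lam) (cf_fun c As) (cf_graph c As lam) + \<delta>)"
proof -
  \<comment> \<open>The memberships stand inside the existential, so that the graphs can be chosen
    as a total function of \<open>As\<close> and \<open>lam\<close>.\<close>
  have "\<exists>H :: 'v learning_graph. As \<in> states (offset l r) \<longrightarrow> lam \<in> cf_data c As \<rightarrow>\<^sub>E UNIV \<longrightarrow>
    adaptive_learning_graph (cf_N c) (subdomain c As lam) (cf_fun c As) H \<and>
    (\<forall>y\<in>subdomain c As lam. cf_fun c As y \<longrightarrow> C1 H y \<le> 1) \<and>
    (\<forall>x\<in>subdomain c As lam. C0 H x \<le>
       C0 (cf_graph c As lam) x * C1_max (subdomain c As lam) (cf_fun c As) (cf_graph c As lam) + \<delta>)" for As lam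
  proof (cases "As \<in> states (offset l r) \<and> lam \<in> cf_data c As \<rightarrow>\<^sub>E UNIV")
    case True
    then have "adaptive_learning_graph (cf_N c) (subdomain c As lam) (cf_fun c As) (cf_graph c As lam)"
      using valid states_end_full unfolding valid_configuration_def by blast
    moreover have "finite (subdomain c As lam)"
      unfolding subdomain_def using finite_cube by simp
    ultimately show ?thesis using normalised_learning_graph assms by blast
  qed blast
  then show ?thesis by metis
qed

theorem johnson_graph:
  assumes S: "0 < S" and C: "0 < C"
    and costs: "\<And>x. x \<in> zeros r c \<Longrightarrow> setup_cost r l c \<le> S\<^sup>2 \<and> checking_cost r c x \<le> C\<^sup>2 \<and>
        (\<forall>i<r. \<forall>h. k i - l i \<le> h \<and> h < k i \<longrightarrow> update_cost r l c i h \<le> (U i)\<^sup>2)"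
  shows "\<exists>G :: nat learning_graph.
    adaptive_learning_graph (cf_N c) (cube (cf_N c)) (target r c) G \<and>
    (\<forall>y\<in>ones r c. C1 G y \<le> 1) \<and>
    (\<forall>x\<in>zeros r c. C0 G x \<le> walk_constant r l *
       (S\<^sup>2 + (\<Sum>i<r. (\<Prod>j\<le>i. (real (n j) / real (k j)) ^ l j) * real (k i) * (U i)\<^sup>2) +
        (\<Prod>i<r. (real (n i) / real (k i)) ^ l i) * C\<^sup>2))"
proof -
  let ?L = "offset l r"
  \<comment> \<open>Each inner graph may exceed the product of its complexities by
    \<open>C\<^sup>2\<close>; after averaging this only doubles the checking bound.\<close>
  have "0 < C\<^sup>2" using C by simp
  from inner_graphs_exist[OF this] obtain H :: "state list \<Rightarrow> input \<Rightarrow> 'v learning_graph" where H: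
    "\<And>As lam. As \<in> states ?L \<Longrightarrow> lam \<in> cf_data c As \<rightarrow>\<^sub>E UNIV \<Longrightarrow>
      adaptive_learning_graph (cf_N c) (subdomain c As lam) (cf_fun c As) (H As lam)"
    "\<And>As lam y. As \<in> states ?L \<Longrightarrow> lam \<in> cf_data c As \<rightarrow>\<^sub>E UNIV \<Longrightarrow>
      y \<in> subdomain c As lam \<Longrightarrow> cf_fun c As y \<Longrightarrow> C1 (H As lam) y \<le> 1"
    "\<And>As lam x. As \<in> states ?L \<Longrightarrow> lam \<in> cf_data c As \<rightarrow>\<^sub>E UNIV \<Longrightarrow>
      x \<in> subdomain c As lam \<Longrightarrow> C0 (H As lam) x \<le>
       C0 (cf_graph c As lam) x * C1_max (subdomain c As lam) (cf_fun c As) (cf_graph c As lam) + C\<^sup>2"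
    by blast
  have asg: "restrict x (cf_data c As) \<in> cf_data c As \<rightarrow>\<^sub>E UNIV" for x :: input and As by auto
  have sub: "x \<in> cube (cf_N c) \<Longrightarrow> x \<in> subdomain c As (restrict x (cf_data c As))" for x As
    by (simp add: subdomain_def)
  \<comment> \<open>Time is shifted by one: time 0 is an artificial root, joined to all starting
    tuples by the edges that load their data.\<close>
  define V where "V t = (case t of 0 \<Rightarrow> {[]} | Suc t \<Rightarrow> states t)" for t
  define E where "E t = (case t of 0 \<Rightarrow> {[]} \<times> states 0 | Suc t \<Rightarrow> moves t)" for t
  define lab where "lab t As = (case t of 0 \<Rightarrow> {} | Suc t \<Rightarrow> cf_data c As)" for t :: nat and As
  define path where "path y As t = (case t of 0 \<Rightarrow> [] | Suc t \<Rightarrow> state_at y As t)" for y As t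
  define M where "M = 4 ^ r / real (card (states 0))"
  have ones: "y \<in> ones r c" if "y \<in> cube (cf_N c)" "target r c y" for y
    using that by (simp add: ones_def)
  interpret W: nested_walk "cf_N c" "target r c" "Suc ?L" V E "[]" lab "cf_fun c" H "\<lambda>y. reach r y"
      probability path M
  proof
    show "0 < M" using card_states_0 by (simp add: M_def)
    show "finite (V t)" for t by (cases t) (auto simp: V_def finite_states)
    show "E t \<subseteq> V t \<times> V (Suc t)" if "t < Suc ?L" for t
      using that moves_sub(1) by (cases t) (auto simp: V_def E_def)
    show "lab t As \<subseteq> {..<cf_N c}" if "As \<in> V t" for t As
      using that data_sub by (cases t) (auto simp: V_def lab_def)
    show "lab t As \<subseteq> lab (Suc t) Bs" if "t < Suc ?L" "(As, Bs) \<in> E t" for t As Bs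
      using that moves_sub(2) by (cases t) (auto simp: E_def lab_def)
    show "adaptive_learning_graph (cf_N c) {z \<in> cube (cf_N c). restrict z (lab (Suc ?L) As) = lam}
        (cf_fun c As) (H As lam)" if "As \<in> V (Suc ?L)" "lam \<in> lab (Suc ?L) As \<rightarrow>\<^sub>E UNIV" for As lam
      using H(1)[of As lam] that by (simp add: V_def lab_def subdomain_def)
    show "C1 (H As (restrict y (lab (Suc ?L) As))) y \<le> 1"
      if "As \<in> V (Suc ?L)" "y \<in> cube (cf_N c)" "cf_fun c As y" for As y
      using H(2)[OF _ asg sub] that by (simp add: V_def lab_def)
    show "target r c z" if "As \<in> V (Suc ?L)" "cf_fun c As z" for As z
      using that states_end_full by (auto simp: V_def target_def)
    show "finite (reach r y)" if "y \<in> cube (cf_N c)" "target r c y" for y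
      using reach_facts[OF ones[OF that]] by blast
    show "0 \<le> probability y As" if "y \<in> cube (cf_N c)" "target r c y" for y As
      by (rule probability_nonneg[OF ones[OF that]])
    show "probability y As \<le> M" if "y \<in> cube (cf_N c)" "target r c y" "As \<in> reach r y" for y As
      unfolding M_def by (rule probability_le[OF ones[OF that(1,2)] that(3)])
    show "(\<Sum>As\<in>reach r y. probability y As) = 1" if "y \<in> cube (cf_N c)" "target r c y" for y
      using reach_facts[OF ones[OF that]] by blast
    show "(path y As t, path y As (Suc t)) \<in> E t"
      if "y \<in> cube (cf_N c)" "target r c y" "As \<in> reach r y" "t < Suc ?L" for y As t
      using state_at_states[OF ones[OF that(1,2)] that(3)] state_at_moves[OF ones[OF that(1,2)] that(3)] that(4)
      by (cases t) (auto simp: path_def E_def)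
    show "inj_on (\<lambda>As. path y As t) (reach r y)"
      if "y \<in> cube (cf_N c)" "target r c y" "0 < t" for y t
      using state_at_inj[OF ones[OF that(1,2)]] that(3) by (cases t) (auto simp: path_def)
    show "cf_fun c (path y As (Suc ?L)) y"
      if "y \<in> cube (cf_N c)" "target r c y" "As \<in> reach r y" for y As
      using state_at_end[OF ones[OF that(1,2)] that(3)] by (simp add: path_def)
  qed (auto simp: V_def lab_def path_def)
  \<comment> \<open>The slack for the copies with wrong assignments; it is absorbed by the setup
    term.\<close>
  have "0 < S\<^sup>2" using S by simp
  from W.nested_walk_graph[OF this] obtain G' :: "(state list, 'v) nested_vertex learning_graph" where G':
    "adaptive_learning_graph (cf_N c) (cube (cf_N c)) (target r c) G'"
    "\<And>y. y \<in> cube (cf_N c) \<Longrightarrow> target r c y \<Longrightarrow> C1 G' y \<le> 1"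
    "\<And>x. x \<in> cube (cf_N c) \<Longrightarrow> C0 G' x \<le> real (Suc ?L + 1) * M *
      ((\<Sum>t<Suc ?L. \<Sum>(a, b)\<in>E t. (real (card (lab (Suc t) b - lab t a)))\<^sup>2) +
       (\<Sum>a\<in>V (Suc ?L). C0 (H a (restrict x (lab (Suc ?L) a))) x)) + S\<^sup>2"
    by blast
  obtain G :: "nat learning_graph" where G:
    "adaptive_learning_graph (cf_N c) (cube (cf_N c)) (target r c) G"
    "\<And>x. C0 G x = C0 G' x" "\<And>y. C1 G y = C1 G' y"
    using learning_graph_on_nat[OF G'(1)] by blast
  \<comment> \<open>All cost bounds are conditional on a negative input, so they enter only here,
    after the graph has been fixed.\<close>
  have bound: "C0 G x \<le> walk_constant r l *
       (S\<^sup>2 + (\<Sum>i<r. (\<Prod>j\<le>i. (real (n j) / real (k j)) ^ l j) * real (k i) * (U i)\<^sup>2) +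
        (\<Prod>i<r. (real (n i) / real (k i)) ^ l i) * C\<^sup>2)" if x: "x \<in> zeros r c" for x
  proof -
    have xc: "x \<in> cube (cf_N c)" using x by (simp add: zeros_def)
    define D where "D = real (card (states 0))"
    define K1 where "K1 = (\<Prod>j<r. real ((l j)\<^sup>2) ^ l j)"
    define R where "R i = (\<Prod>j\<le>i. (real (n j) / real (k j)) ^ l j) * real (k i)" for i
    define X where "X = (\<Sum>i<r. R i * (U i)\<^sup>2)"
    define Y where "Y = (\<Prod>i<r. (real (n i) / real (k i)) ^ l i) * C\<^sup>2"
    have D: "0 < D" using card_states_0 by (simp add: D_def)
    have K1: "1 \<le> K1"
      unfolding K1_def using l_bounds(1) by (intro prod_ge_1) (simp add: Suc_leI)
    have R: "0 \<le> R i" for i by (auto simp: R_def intro!: prod_nonneg mult_nonneg_nonneg)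
    have X: "0 \<le> X" unfolding X_def by (intro sum_nonneg mult_nonneg_nonneg R) simp
    have Y: "0 \<le> Y" by (auto simp: Y_def intro!: prod_nonneg mult_nonneg_nonneg)
    have mv: "(\<Sum>(As, Bs)\<in>moves t. (real (card (cf_data c Bs - cf_data c As)))\<^sup>2) \<le> D * K1 * X"
      if t: "t < ?L" for t
    proof -
      let ?i = "level l r t"
      have i: "?i < r" using level_props(1)[OF t] .
      have h: "k ?i - l ?i \<le> height t ?i" "height t ?i < k ?i"
        using progress_level(3)[OF t] l_bounds(2)[OF i] by (auto simp: height_def)
      then have u: "update_cost r l c ?i (height t ?i) \<le> (U ?i)\<^sup>2" using costs[OF x] i by blast
      have "(\<Sum>(As, Bs)\<in>moves t. (real (card (cf_data c Bs - cf_data c As)))\<^sup>2) \<le>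
          real (card (states t) * (n ?i - height t ?i) * (k ?i - height t ?i)) * (U ?i)\<^sup>2"
        unfolding sum_moves[OF t] using u by (rule mult_left_mono) simp
      also have "\<dots> \<le> D * K1 * R ?i * (U ?i)\<^sup>2"
        using card_states_moves_le[OF t] unfolding D_def K1_def R_def by (rule mult_right_mono) simp
      also have "\<dots> = D * K1 * (R ?i * (U ?i)\<^sup>2)" by (simp add: mult.assoc)
      \<comment> \<open>A crude estimate: a step of level \<open>?i\<close> is charged all of
        \<open>X\<close>, which is affordable because the number of steps is a constant.\<close>
      also have "\<dots> \<le> D * K1 * X"
      proof (rule mult_left_mono)
        show "R ?i * (U ?i)\<^sup>2 \<le> X"
          unfolding X_def using i R by (intro member_le_sum) auto
      qed (use D K1 in simp)
      finally show ?thesis .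
    qed
    \<comment> \<open>The layer at the root starts from the empty label, so its lengths are the full
      sizes of the data, the setup cost.\<close>
    have "(\<Sum>t<Suc ?L. \<Sum>(a, b)\<in>E t. (real (card (lab (Suc t) b - lab t a)))\<^sup>2) =
        (\<Sum>As\<in>states 0. (real (card (cf_data c As)))\<^sup>2) +
        (\<Sum>t<?L. \<Sum>(As, Bs)\<in>moves t. (real (card (cf_data c Bs - cf_data c As)))\<^sup>2)"
      unfolding sum.lessThan_Suc_shift by (simp add: E_def lab_def sum.cartesian_product[symmetric])
    also have "\<dots> \<le> D * S\<^sup>2 + (\<Sum>t<?L. D * K1 * X)"
      unfolding setup_sum D_def[symmetric]
      using costs[OF x] D mv by (intro add_mono sum_mono mult_left_mono) auto
    finally have walk: "(\<Sum>t<Suc ?L. \<Sum>(a, b)\<in>E t. (real (card (lab (Suc t) b - lab t a)))\<^sup>2) \<le>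
        D * S\<^sup>2 + real ?L * (D * K1 * X)" by simp
    have "(\<Sum>a\<in>V (Suc ?L). C0 (H a (restrict x (lab (Suc ?L) a))) x) \<le>
        (\<Sum>As\<in>states ?L. C0 (cf_graph c As (restrict x (cf_data c As))) x *
          C1_max (subdomain c As (restrict x (cf_data c As))) (cf_fun c As)
            (cf_graph c As (restrict x (cf_data c As))) + C\<^sup>2)"
      unfolding V_def lab_def nat.case by (intro sum_mono H(3)[OF _ asg sub[OF xc]])
    also have "\<dots> = real (card (states ?L)) * (checking_cost r c x + C\<^sup>2)"
      by (simp add: sum.distrib checking_sum distrib_left)
    also have "\<dots> \<le> real (card (states ?L)) * (2 * C\<^sup>2)"
      using costs[OF x] by (intro mult_left_mono) auto
    also have "\<dots> \<le> (D * K1 * (\<Prod>j<r. (real (n j) / real (k j)) ^ l j)) * (2 * C\<^sup>2)"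
      using card_states_end_le unfolding D_def K1_def by (rule mult_right_mono) simp
    also have "\<dots> = D * K1 * (2 * Y)" by (simp add: Y_def mult_ac)
    finally have check: "(\<Sum>a\<in>V (Suc ?L). C0 (H a (restrict x (lab (Suc ?L) a))) x) \<le> D * K1 * (2 * Y)" .
    have "C0 G x \<le> real (Suc ?L + 1) * M *
        ((\<Sum>t<Suc ?L. \<Sum>(a, b)\<in>E t. (real (card (lab (Suc t) b - lab t a)))\<^sup>2) +
         (\<Sum>a\<in>V (Suc ?L). C0 (H a (restrict x (lab (Suc ?L) a))) x)) + S\<^sup>2"
      unfolding G(2) by (rule G'(3)[OF xc])
    also have "\<dots> \<le> real (Suc ?L + 1) * M * (D * S\<^sup>2 + real ?L * (D * K1 * X) + D * K1 * (2 * Y)) + S\<^sup>2"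
      using walk check W.M_pos by (intro add_right_mono mult_left_mono add_mono) auto
    \<comment> \<open>\<open>M\<close> equals \<open>4 ^ r / D\<close>, so the number
      \<open>D\<close> of starting tuples cancels.\<close>
    also have "\<dots> = (real ?L + 2) * 4 ^ r * (S\<^sup>2 + real ?L * (K1 * X) + 2 * (K1 * Y)) + S\<^sup>2"
      using D by (simp add: M_def D_def[symmetric] field_simps)
    also have "\<dots> \<le> (real ?L + 2) * 4 ^ r * ((real ?L + 2) * (K1 * (S\<^sup>2 + X + Y))) + (S\<^sup>2 + X + Y)"
    proof (intro add_mono mult_left_mono)
      have "1 * S\<^sup>2 \<le> K1 * S\<^sup>2" using K1 by (intro mult_right_mono) auto
      then have "S\<^sup>2 \<le> K1 * S\<^sup>2" by simp
      moreover have "0 \<le> K1 * X" "0 \<le> K1 * Y" "0 \<le> K1 * S\<^sup>2" using K1 X Y by auto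
      then have "0 \<le> real ?L * (K1 * Y)" "0 \<le> real ?L * (K1 * S\<^sup>2)" by auto
      ultimately have "S\<^sup>2 + real ?L * (K1 * X) + 2 * (K1 * Y) \<le>
          (real ?L * (K1 * S\<^sup>2) + 2 * (K1 * S\<^sup>2)) + (real ?L * (K1 * X) + 2 * (K1 * X)) +
          (real ?L * (K1 * Y) + 2 * (K1 * Y))"
        using \<open>0 \<le> K1 * X\<close> \<open>0 \<le> K1 * S\<^sup>2\<close> by linarith
      also have "\<dots> = (real ?L + 2) * (K1 * (S\<^sup>2 + X + Y))" by (simp add: algebra_simps)
      finally show "S\<^sup>2 + real ?L * (K1 * X) + 2 * (K1 * Y) \<le> (real ?L + 2) * (K1 * (S\<^sup>2 + X + Y))" .
    qed (use X Y in auto)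
    also have "\<dots> = walk_constant r l * (S\<^sup>2 + X + Y)"
      unfolding walk_constant_def K1_def[symmetric] by (simp add: power2_eq_square algebra_simps)
    finally show ?thesis unfolding X_def Y_def R_def .
  qed
  show ?thesis
    using G(1,3) G'(2) bound by (intro exI[of _ G]) (auto simp: ones_def)
qed

end

section \<open>Passage to the asymptotic statement\<close>

theorem lemma25:
  fixes r :: nat and l :: "nat \<Rightarrow> nat"
    and c :: "nat \<Rightarrow> 'v configuration"
    and S C :: "nat \<Rightarrow> real" and U :: "nat \<Rightarrow> nat \<Rightarrow> real"
  assumes k_small: "\<forall>i<r. (\<lambda>m. real (cf_k (c m) i)) \<in> o(\<lambda>m. real (cf_n (c m) i))"
    and alpha_small: "(\<lambda>m. cf_alpha (c m)) \<in> o(\<lambda>_. 1)"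
    and adm: "\<forall>\<^sub>F m in sequentially. admissible r l (c m)"
    and pos: "\<forall>\<^sub>F m in sequentially. 0 < S m \<and> 0 < C m \<and> (\<forall>i<r. 0 < U m i)"
    and costs: "\<forall>\<^sub>F m in sequentially. \<forall>x\<in>zeros r (c m).
        setup_cost r l (c m) \<le> (S m)\<^sup>2 \<and>
        checking_cost r (c m) x \<le> (C m)\<^sup>2 \<and>
        (\<forall>i<r. \<forall>h. cf_k (c m) i - l i \<le> h \<and> h < cf_k (c m) i \<longrightarrow>
           update_cost r l (c m) i h \<le> (U m i)\<^sup>2)"
  shows "\<exists>(G :: nat \<Rightarrow> nat learning_graph) K. \<forall>\<^sub>F m in sequentially.
      adaptive_learning_graph (cf_N (c m)) (cube (cf_N (c m))) (target r (c m)) (G m) \<and>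
      (\<forall>y\<in>ones r (c m). C1 (G m) y \<le> 1) \<and>
      (\<forall>x\<in>zeros r (c m). C0 (G m) x \<le> K *
         ((S m)\<^sup>2 +
          (\<Sum>i<r. (\<Prod>j\<le>i. (real (cf_n (c m) j) / real (cf_k (c m) j)) ^ l j)
                  * real (cf_k (c m) i) * (U m i)\<^sup>2) +
          (\<Prod>i<r. (real (cf_n (c m) i) / real (cf_k (c m) i)) ^ l i) * (C m)\<^sup>2))"
proof -
  \<comment> \<open>The constant is \<open>walk_constant r l\<close>, which does not involve
    \<open>m\<close>; this is what turns the bound into an O.\<close>
  let ?good = "\<lambda>m G. adaptive_learning_graph (cf_N (c m)) (cube (cf_N (c m))) (target r (c m)) G \<and>
      (\<forall>y\<in>ones r (c m). C1 G y \<le> 1) \<and>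
      (\<forall>x\<in>zeros r (c m). C0 G x \<le> walk_constant r l *
         ((S m)\<^sup>2 +
          (\<Sum>i<r. (\<Prod>j\<le>i. (real (cf_n (c m) j) / real (cf_k (c m) j)) ^ l j)
                  * real (cf_k (c m) i) * (U m i)\<^sup>2) +
          (\<Prod>i<r. (real (cf_n (c m) i) / real (cf_k (c m) i)) ^ l i) * (C m)\<^sup>2))"
  have large: "\<forall>\<^sub>F m in sequentially. \<forall>i\<in>{..<r}. 4 * l i * cf_k (c m) i \<le> cf_n (c m) i"
  proof (rule eventually_ball_finite)
    show "\<forall>i\<in>{..<r}. \<forall>\<^sub>F m in sequentially. 4 * l i * cf_k (c m) i \<le> cf_n (c m) i"
    proof
      fix i assume "i \<in> {..<r}"
      then have o: "(\<lambda>m. real (cf_k (c m) i)) \<in> o(\<lambda>m. real (cf_n (c m) i))" using k_small by simp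
      \<comment> \<open>The summand 1 in the denominator keeps the constant positive without
        appealing to \<open>0 < l i\<close>, which belongs to admissibility.\<close>
      have "\<forall>\<^sub>F m in sequentially. norm (real (cf_k (c m) i)) \<le> 1 / (4 * real (l i) + 1) * norm (real (cf_n (c m) i))"
        by (rule landau_o.smallD[OF o]) (simp add: add_nonneg_pos)
      then show "\<forall>\<^sub>F m in sequentially. 4 * l i * cf_k (c m) i \<le> cf_n (c m) i"
      proof (rule eventually_mono)
        fix m assume "norm (real (cf_k (c m) i)) \<le> 1 / (4 * real (l i) + 1) * norm (real (cf_n (c m) i))"
        then have "real (cf_k (c m) i) * (4 * real (l i) + 1) \<le> real (cf_n (c m) i)"
          by (simp add: pos_le_divide_eq add_nonneg_pos)
        then have "real (4 * l i * cf_k (c m) i) \<le> real (cf_n (c m) i)"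
          by (simp add: algebra_simps)
        then show "4 * l i * cf_k (c m) i \<le> cf_n (c m) i" by linarith
      qed
    qed
  qed simp
  have "\<forall>\<^sub>F m in sequentially. norm (cf_alpha (c m)) \<le> 1 / 2 * norm (1 :: real)"
    by (rule landau_o.smallD[OF alpha_small]) simp
  then have alpha: "\<forall>\<^sub>F m in sequentially. cf_alpha (c m) \<le> 1 / 2"
    by (rule eventually_mono) auto
  have "\<forall>\<^sub>F m in sequentially. \<exists>G :: nat learning_graph. ?good m G"
    using large alpha adm pos costs
  proof eventually_elim
    case (elim m)
    then interpret johnson_walk r l "c m" by unfold_locales auto
    show ?case by (rule johnson_graph) (use elim in blast)+
  qed
  \<comment> \<open>Choice turns existence for each large \<open>m\<close> into a sequence of
    graphs, arbitrary at the other \<open>m\<close>.\<close>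
  then have "\<forall>\<^sub>F m in sequentially. ?good m (SOME G :: nat learning_graph. ?good m G)"
    by (rule eventually_mono) (rule someI_ex)
  then show ?thesis by (intro exI[of _ "\<lambda>m. SOME G :: nat learning_graph. ?good m G"] exI[of _ "walk_constant r l"])
qed

end
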